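(* Let $\mathcal{D}^*$ be a fixed, known distribution over $[N]$. There is an algorithm which, given $\varepsilon\in(0,1)$ and \textsc{Cond} access to an arbitrary (unknown) distribution $\mathcal{D}$ over $[N]$, makes $\tilde{O}(\varepsilon^{-4})$ queries and outputs an estimate of $d_{\mathrm{TV}}(\mathcal{D},\mathcal{D}^* )$ within additive error $\varepsilon$ with probability at least $2/3$.
   Context: For a distribution $\mathcal{D}$ over $[N]$ write $D(i)=\Pr_{x\sim\mathcal{D}}(x=i)$, $D(S)=\sum_{i\in S}D(i)$. The \textsc{Cond} oracle takes a set $S\subseteq[N]$ and returns $i\in S$ with probability $D(i)/D(S)$, independently of previous calls. $d_{\mathrm{TV}}(\mathcal{D}_1,\mathcal{D}_2)=\frac12\sum_i|D_1(i)-D_2(i)|$. $\tilde O(\cdot)$ hides factors polylogarithmic in $1/\varepsilon$; the bound does not depend on $N$. *)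

theory Defs
  imports "HOL-Probability.Probability"
begin

definition distribution_on :: "nat \<Rightarrow> nat pmf \<Rightarrow> bool" where
  "distribution_on N D \<longleftrightarrow> set_pmf D \<subseteq> {1..N}"

definition d_TV :: "nat \<Rightarrow> nat pmf \<Rightarrow> nat pmf \<Rightarrow> real" where
  "d_TV N D1 D2 = 1 / 2 * (\<Sum>i = 1..N. \<bar>pmf D1 i - pmf D2 i\<bar>)"

text \<open>
  The conditional distribution is undefined when \<open>D(S) = 0\<close>, so the response to such a query is
  left unconstrained. It may be the uniform distribution on \<open>S\<close>, or a failure signal such as the
  value \<open>0\<close>, which is not an element of \<open>{1..N}\<close>.
\<close>
definition is_cond_oracle :: "nat \<Rightarrow> nat pmf \<Rightarrow> (nat set \<Rightarrow> nat pmf) \<Rightarrow> bool" where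
  "is_cond_oracle N D orc \<longleftrightarrow>
     (\<forall>S. S \<subseteq> {1..N} \<and> measure_pmf.prob D S > 0 \<longrightarrow>
        (\<forall>i\<in>S. pmf (orc S) i = pmf D i / measure_pmf.prob D S))"

text \<open>
  Adaptive randomized query algorithms: \<open>Sample\<close> uses internal randomness at no cost, \<open>Query\<close>
  calls the oracle, and each continues depending on the value obtained.
\<close>
datatype cond_alg =
    Output real
  | Sample "nat pmf" "nat \<Rightarrow> cond_alg"
  | Query "nat set" "nat \<Rightarrow> cond_alg"

primrec query_sets :: "cond_alg \<Rightarrow> nat set set" where
  "query_sets (Output v) = {}"
| "query_sets (Sample p f) = (\<Union>i. query_sets (f i))"
| "query_sets (Query S f) = insert S (\<Union>i. query_sets (f i))"

text \<open>
  Joint distribution of the output and the number of oracle calls. Every call draws afresh from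
  the response distribution, which makes the calls independent.
\<close>
primrec run :: "(nat set \<Rightarrow> nat pmf) \<Rightarrow> cond_alg \<Rightarrow> (real \<times> nat) pmf" where
  "run orc (Output v) = return_pmf (v, 0)"
| "run orc (Sample p f) = bind_pmf p (\<lambda>i. run orc (f i))"
| "run orc (Query S f) =
     bind_pmf (orc S) (\<lambda>i. map_pmf (\<lambda>(v, q). (v, Suc q)) (run orc (f i)))"

end

theory Submission
  imports Defs "HOL-Library.Nat_Bijection"
begin

text \<open>
  The distance is \<open>1 - E min(1, D*(i) / D(i))\<close> for \<open>i\<close> drawn from \<open>D\<close>, so averaging \<open>O(\<epsilon>^-2)\<close>
  samples leaves the task of estimating \<open>min(1, D*(i) / D(i))\<close> for a given \<open>i\<close> with \<open>O(\<epsilon>^-2)\<close>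
  queries and, on average over \<open>i\<close>, bias \<open>O(\<epsilon>)\<close>. Let \<open>F\<close> be the probability that \<open>i\<close> is returned by
  a query of \<open>{i, j}\<close>, where \<open>j\<close> is drawn from \<open>D\<close>. Put every other element into a set \<open>S\<close>
  independently with probability \<open>D*(i)\<close>, and let \<open>X\<close> be the number of elements of \<open>S\<close> that appear
  before \<open>i\<close> when sampling from \<open>S \<union> {i}\<close> without replacement. The element \<open>j\<close> precedes \<open>i\<close> with
  probability \<open>D(j) / (D(i) + D(j))\<close> regardless of the rest of \<open>S\<close>, and therefore
  \<open>D*(i) + E X = F * D*(i) / D(i)\<close>: the ratio of the two estimable quantities is the one sought.

  The variance of \<open>X\<close> is \<open>O(E X + (E X)^2)\<close>, so \<open>m\<close> repetitions give bias
  \<open>O(1 / sqrt(m F))\<close>. As \<open>F\<close> is at least half of the mass of the elements that are no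
  heavier than \<open>i\<close>, the sum of \<open>D(i) / sqrt F(i)\<close> over \<open>i\<close> is bounded like the integral of
  \<open>x^(-1/2)\<close> over the unit interval. Since the ratio is capped at \<open>1\<close>, counting can stop as soon
  as the total count exceeds \<open>m\<close>, which bounds the number of queries.
\<close>


section \<open>Finitely supported expectations\<close>

abbreviation expect :: "'a pmf \<Rightarrow> ('a \<Rightarrow> real) \<Rightarrow> real" where
  "expect p f \<equiv> measure_pmf.expectation p f"

lemma expect_bind_finite:
  assumes "finite (set_pmf p)" "\<And>x. x \<in> set_pmf p \<Longrightarrow> finite (set_pmf (f x))"
  shows "expect (bind_pmf p f) h = expect p (\<lambda>x. expect (f x) h)"
proof -
  have "expect (bind_pmf p f) h = (\<Sum>a\<in>set_pmf p. pmf p a *\<^sub>R expect (f a) h)"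
    by (rule pmf_expectation_bind) (use assms in auto)
  also have "\<dots> = expect p (\<lambda>x. expect (f x) h)"
    by (rule integral_measure_pmf[symmetric]) (use assms in auto)
  finally show ?thesis .
qed

lemma expect_add_finite:
  assumes "finite (set_pmf p)"
  shows "expect p (\<lambda>x. f x + g x) = expect p f + expect p g"
  using assms by (intro Bochner_Integration.integral_add integrable_measure_pmf_finite)

lemma expect_diff_finite:
  assumes "finite (set_pmf p)"
  shows "expect p (\<lambda>x. f x - g x) = expect p f - expect p g"
  using assms by (intro Bochner_Integration.integral_diff integrable_measure_pmf_finite)

lemma expect_mono_finite:
  assumes "finite (set_pmf p)" "\<And>x. x \<in> set_pmf p \<Longrightarrow> f x \<le> g x"
  shows "expect p f \<le> expect p g"
  using assms by (intro integral_mono_AE integrable_measure_pmf_finite) (auto simp: AE_measure_pmf_iff)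

lemma expect_cong:
  assumes "\<And>x. x \<in> set_pmf p \<Longrightarrow> f x = g x"
  shows "expect p f = expect p g"
  using assms by (intro integral_cong_AE) (auto simp: AE_measure_pmf_iff)

text \<open>The variance of \<open>\<bar>f x\<bar>\<close> is nonnegative; this is Cauchy-Schwarz
  against the constant 1.\<close>

lemma expect_abs_le_sqrt:
  assumes "finite (set_pmf p)"
  shows "expect p (\<lambda>x. \<bar>f x\<bar>) \<le> sqrt (expect p (\<lambda>x. (f x)\<^sup>2))"
proof -
  define c where "c = expect p (\<lambda>x. \<bar>f x\<bar>)"
  have "0 \<le> expect p (\<lambda>x. (\<bar>f x\<bar> - c)\<^sup>2)"
    by (intro integral_nonneg_AE) auto
  also have "\<dots> = expect p (\<lambda>x. ((f x)\<^sup>2 - 2 * c * \<bar>f x\<bar>) + c\<^sup>2)"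
    by (intro expect_cong) (simp add: power2_diff algebra_simps)
  also have "\<dots> = expect p (\<lambda>x. (f x)\<^sup>2) - c\<^sup>2"
    using assms by (simp add: expect_add_finite expect_diff_finite c_def power2_eq_square)
  finally have "c\<^sup>2 \<le> expect p (\<lambda>x. (f x)\<^sup>2)" by simp
  thus ?thesis unfolding c_def by (rule real_le_rsqrt)
qed

lemma expect_variance_finite:
  assumes "finite (set_pmf p)"
  shows "expect p (\<lambda>x. (f x - expect p f)\<^sup>2) = expect p (\<lambda>x. (f x)\<^sup>2) - (expect p f)\<^sup>2"
proof -
  define c where "c = expect p f"
  have "expect p (\<lambda>x. (f x - c)\<^sup>2) = expect p (\<lambda>x. ((f x)\<^sup>2 - 2 * c * f x) + c\<^sup>2)"
    by (intro expect_cong) (simp add: power2_diff algebra_simps)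
  also have "\<dots> = expect p (\<lambda>x. (f x)\<^sup>2) - c\<^sup>2"
    using assms by (simp add: expect_add_finite expect_diff_finite c_def power2_eq_square)
  finally show ?thesis by (simp add: c_def)
qed

section \<open>Sums of independent samples: variance, mean deviation, Chebyshev\<close>

primrec iid_sum :: "nat \<Rightarrow> real pmf \<Rightarrow> real pmf" where
  "iid_sum 0 p = return_pmf 0"
| "iid_sum (Suc n) p = bind_pmf p (\<lambda>x. map_pmf (\<lambda>y. x + y) (iid_sum n p))"

lemma finite_iid_sum [intro]: "finite (set_pmf p) \<Longrightarrow> finite (set_pmf (iid_sum n p))"
  by (induction n) auto

lemma iid_sum_nonneg:
  "(\<And>x. x \<in> set_pmf p \<Longrightarrow> 0 \<le> x) \<Longrightarrow> y \<in> set_pmf (iid_sum n p) \<Longrightarrow> 0 \<le> y"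
  by (induction n arbitrary: y) force+

lemma iid_sum_le:
  "(\<And>x. x \<in> set_pmf p \<Longrightarrow> x \<le> 1) \<Longrightarrow> y \<in> set_pmf (iid_sum n p) \<Longrightarrow> y \<le> n"
  by (induction n arbitrary: y) force+

lemma expect_iid_sum:
  assumes "finite (set_pmf p)"
  shows "expect (iid_sum n p) (\<lambda>x. x) = n * expect p (\<lambda>x. x)"
  using assms
  by (induction n) (simp_all add: expect_bind_finite finite_iid_sum expect_add_finite algebra_simps)

text \<open>Splitting off the first sample leaves a cross term that vanishes, because the centred
  remaining sum has mean zero.\<close>

lemma variance_iid_sum:
  assumes "finite (set_pmf p)"
  shows "expect (iid_sum n p) (\<lambda>x. (x - n * expect p (\<lambda>x. x))\<^sup>2)
           = n * expect p (\<lambda>x. (x - expect p (\<lambda>x. x))\<^sup>2)"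
proof (induction n)
  case (Suc n)
  define \<mu> where "\<mu> = expect p (\<lambda>x. x)"
  have "expect (iid_sum n p) (\<lambda>y. (x + y - Suc n * \<mu>)\<^sup>2) = (x - \<mu>)\<^sup>2 + n * expect p (\<lambda>x. (x - \<mu>)\<^sup>2)" for x
  proof -
    have "expect (iid_sum n p) (\<lambda>y. (x + y - Suc n * \<mu>)\<^sup>2)
        = expect (iid_sum n p) (\<lambda>y. ((x - \<mu>)\<^sup>2 + 2 * (x - \<mu>) * (y - n * \<mu>)) + (y - n * \<mu>)\<^sup>2)"
      by (intro expect_cong) (simp add: power2_eq_square algebra_simps)
    also have "\<dots> = (x - \<mu>)\<^sup>2 + n * expect p (\<lambda>x. (x - \<mu>)\<^sup>2)"
      using assms Suc.IH
      by (simp add: expect_add_finite expect_diff_finite finite_iid_sum expect_iid_sum \<mu>_def)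
    finally show ?thesis .
  qed
  then show ?case
    using assms
    by (simp add: expect_bind_finite finite_iid_sum expect_add_finite \<mu>_def algebra_simps
        del: of_nat_Suc)
      (simp add: algebra_simps)
qed simp

text \<open>A first absolute moment instead of a tail bound: the inner estimates only have to be
  nearly unbiased, and concentration is left to the outer average.\<close>

lemma iid_mean_deviation:
  assumes "finite (set_pmf p)" "n > 0" "expect p (\<lambda>x. (x - expect p (\<lambda>x. x))\<^sup>2) \<le> V"
  shows "expect (iid_sum n p) (\<lambda>x. \<bar>x / n - expect p (\<lambda>x. x)\<bar>) \<le> sqrt (V / n)"
proof -
  define \<mu> where "\<mu> = expect p (\<lambda>x. x)"
  have "expect (iid_sum n p) (\<lambda>x. \<bar>x / n - \<mu>\<bar>)
          \<le> sqrt (expect (iid_sum n p) (\<lambda>x. (x / n - \<mu>)\<^sup>2))"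
    using assms by (intro expect_abs_le_sqrt) auto
  also have "expect (iid_sum n p) (\<lambda>x. (x / n - \<mu>)\<^sup>2)
      = expect (iid_sum n p) (\<lambda>x. (x - n * \<mu>)\<^sup>2 / (real n)\<^sup>2)"
    using assms by (intro expect_cong) (simp add: field_simps power2_eq_square)
  also have "\<dots> = n * expect p (\<lambda>x. (x - \<mu>)\<^sup>2) / (real n)\<^sup>2"
    using assms by (simp add: variance_iid_sum \<mu>_def)
  also have "\<dots> = expect p (\<lambda>x. (x - \<mu>)\<^sup>2) / n"
    using assms by (simp add: power2_eq_square[of "real n"])
  also have "sqrt \<dots> \<le> sqrt (V / n)"
    using assms by (simp add: \<mu>_def divide_right_mono)
  finally show ?thesis by (simp add: \<mu>_def)
qed

lemma iid_mean_Chebyshev: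
  assumes "finite (set_pmf p)" "n > 0" "c > 0" "expect p (\<lambda>x. (x - expect p (\<lambda>x. x))\<^sup>2) \<le> V"
  shows "measure_pmf.prob (iid_sum n p) {x. \<bar>x / n - expect p (\<lambda>x. x)\<bar> \<ge> c} \<le> V / (n * c\<^sup>2)"
proof -
  define \<mu> where "\<mu> = expect p (\<lambda>x. x)"
  have "measure_pmf.prob (iid_sum n p) {x. \<bar>x / n - \<mu>\<bar> \<ge> c}
      = measure_pmf.prob (iid_sum n p) {x \<in> space (measure_pmf (iid_sum n p)). (x - n * \<mu>)\<^sup>2 \<ge> (n * c)\<^sup>2}"
  proof -
    have "\<bar>x / n - \<mu>\<bar> \<ge> c \<longleftrightarrow> (x - n * \<mu>)\<^sup>2 \<ge> (n * c)\<^sup>2" for x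
    proof -
      have "x / n - \<mu> = (x - n * \<mu>) / n" using assms by (simp add: field_simps)
      hence "\<bar>x / n - \<mu>\<bar> \<ge> c \<longleftrightarrow> \<bar>x - n * \<mu>\<bar> \<ge> \<bar>n * c\<bar>" 
        using assms by (simp add: field_simps abs_mult)
      thus ?thesis by (simp only: abs_le_square_iff)
    qed
    thus ?thesis by simp
  qed
  also have "\<dots> \<le> expect (iid_sum n p) (\<lambda>x. (x - n * \<mu>)\<^sup>2) / (n * c)\<^sup>2"
    using assms by (intro integral_Markov_inequality_measure[where A = "{}"] 
        integrable_measure_pmf_finite) auto
  also have "\<dots> = n * expect p (\<lambda>x. (x - \<mu>)\<^sup>2) / (n * c)\<^sup>2"
    using assms by (simp add: variance_iid_sum \<mu>_def)
  also have "\<dots> \<le> n * V / (n * c)\<^sup>2"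
    using assms by (intro divide_right_mono mult_left_mono) (auto simp: \<mu>_def)
  also have "\<dots> = V / (n * c\<^sup>2)"
    using assms by (simp add: power2_eq_square)
  finally show ?thesis by (simp add: \<mu>_def)
qed

section \<open>Combinators for query algorithms\<close>

primrec bind_alg :: "cond_alg \<Rightarrow> (real \<Rightarrow> cond_alg) \<Rightarrow> cond_alg" where
  "bind_alg (Output v) g = g v"
| "bind_alg (Sample p f) g = Sample p (\<lambda>i. bind_alg (f i) g)"
| "bind_alg (Query S f) g = Query S (\<lambda>i. bind_alg (f i) g)"

primrec repeat_alg :: "nat \<Rightarrow> cond_alg \<Rightarrow> cond_alg" where
  "repeat_alg 0 A = Output 0"
| "repeat_alg (Suc n) A = bind_alg A (\<lambda>x. bind_alg (repeat_alg n A) (\<lambda>y. Output (x + y)))"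

text \<open>The budget is abstracted on the right because recursion over the algorithm hands a
  smaller budget to the continuations.\<close>

primrec limit_alg :: "real \<Rightarrow> cond_alg \<Rightarrow> nat \<Rightarrow> cond_alg" where
  "limit_alg b (Output v) = (\<lambda>n. Output v)"
| "limit_alg b (Sample p f) = (\<lambda>n. Sample p (\<lambda>i. limit_alg b (f i) n))"
| "limit_alg b (Query S f) =
     (\<lambda>n. if n = 0 then Output b else Query S (\<lambda>i. limit_alg b (f i) (n - 1)))"

text \<open>A worst case over all responses, even those outside the queried set, so that the bound
  holds for every oracle.\<close>

primrec queries_le :: "cond_alg \<Rightarrow> nat \<Rightarrow> bool" where
  "queries_le (Output v) = (\<lambda>n. True)"
| "queries_le (Sample p f) = (\<lambda>n. \<forall>i. queries_le (f i) n)"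
| "queries_le (Query S f) = (\<lambda>n. n > 0 \<and> (\<forall>i. queries_le (f i) (n - 1)))"

lemma queries_leD: "queries_le A n \<Longrightarrow> (v, q) \<in> set_pmf (run orc A) \<Longrightarrow> q \<le> n"
proof (induction A arbitrary: n v q)
  case (Sample p f)
  then obtain i where "(v, q) \<in> set_pmf (run orc (f i))" by auto
  thus ?case using Sample.IH[OF rangeI, of i n v q] Sample.prems(1) by simp
next
  case (Query S f)
  from Query.prems obtain i q' where "(v, q') \<in> set_pmf (run orc (f i))" "q = Suc q'"
    by auto
  moreover have "queries_le (f i) (n - 1)" "n > 0" using Query.prems by auto
  ultimately show ?case using Query.IH[OF rangeI, of i "n - 1" v q'] by auto
qed auto

lemma queries_le_mono: "queries_le A n \<Longrightarrow> n \<le> n' \<Longrightarrow> queries_le A n'"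
proof (induction A arbitrary: n n')
  case (Sample p f)
  have "queries_le (f i) n'" for i
    using Sample.IH[OF rangeI, of i n n'] Sample.prems by simp
  thus ?case by simp
next
  case (Query S f)
  have "queries_le (f i) (n' - 1)" for i
    using Query.IH[OF rangeI, of i "n - 1" "n' - 1"] Query.prems by simp
  thus ?case using Query.prems by simp
qed auto

lemma queries_le_bind:
  "queries_le A n \<Longrightarrow> (\<And>v. queries_le (g v) m) \<Longrightarrow> queries_le (bind_alg A g) (n + m)"
proof (induction A arbitrary: n)
  case (Output v)
  thus ?case by (auto intro: queries_le_mono[of _ m])
next
  case (Query S f)
  have "queries_le (bind_alg (f i) g) (n - 1 + m)" for i
    using Query.IH[OF rangeI, of i "n - 1"] Query.prems by simp
  moreover have "n - 1 + m = n + m - 1" using Query.prems by auto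
  ultimately show ?case using Query.prems by auto
qed auto

lemma queries_le_repeat: "queries_le A n \<Longrightarrow> queries_le (repeat_alg k A) (k * n)"
proof (induction k)
  case (Suc k)
  have "queries_le (repeat_alg (Suc k) A) (n + (k * n + 0))"
    unfolding repeat_alg.simps using Suc by (intro queries_le_bind) auto
  thus ?case by simp
qed auto

lemma queries_le_limit: "queries_le (limit_alg b A n) n"
  by (induction A arbitrary: n) auto

lemma query_sets_bind: "query_sets (bind_alg A g) \<subseteq> query_sets A \<union> (\<Union>v. query_sets (g v))"
proof (induction A)
  case (Sample p f)
  show ?case using Sample.IH[OF rangeI] by simp blast
next
  case (Query S f)
  show ?case using Query.IH[OF rangeI] by simp blast
qed auto

lemma query_sets_repeat: "query_sets (repeat_alg n A) \<subseteq> query_sets A"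
proof (induction n)
  case (Suc n)
  have "query_sets (bind_alg (repeat_alg n A) (\<lambda>y. Output (x + y))) \<subseteq> query_sets A" for x
    using query_sets_bind[of "repeat_alg n A" "\<lambda>y. Output (x + y)"] Suc by simp
  thus ?case
    using query_sets_bind[of A "\<lambda>x. bind_alg (repeat_alg n A) (\<lambda>y. Output (x + y))"]
    by simp blast
qed auto

lemma query_sets_limit: "query_sets (limit_alg b A n) \<subseteq> query_sets A"
proof (induction A arbitrary: n)
  case (Sample p f)
  show ?case using Sample.IH[OF rangeI] by simp blast
next
  case (Query S f)
  show ?case using Query.IH[OF rangeI] by (cases n) (simp_all, blast)
qed auto

lemma run_bind:
  "run orc (bind_alg A g) =
     bind_pmf (run orc A) (\<lambda>(v, q). map_pmf (\<lambda>(w, r). (w, q + r)) (run orc (g v)))"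
proof (induction A)
  case (Output v)
  show ?case by (simp add: bind_return_pmf case_prod_unfold pmf.map_ident)
next
  case (Sample p f)
  thus ?case by (simp add: bind_assoc_pmf)
next
  case (Query S f)
  thus ?case
    by (auto simp: bind_assoc_pmf map_bind_pmf bind_map_pmf pmf.map_comp case_prod_unfold o_def
        intro!: bind_pmf_cong)
qed

definition result :: "(nat set \<Rightarrow> nat pmf) \<Rightarrow> cond_alg \<Rightarrow> real pmf" where
  "result orc A = map_pmf fst (run orc A)"

lemma result_simps [simp]:
  "result orc (Output v) = return_pmf v"
  "result orc (Sample p f) = bind_pmf p (\<lambda>i. result orc (f i))"
  "result orc (Query S f) = bind_pmf (orc S) (\<lambda>i. result orc (f i))"
  by (simp_all add: result_def map_bind_pmf pmf.map_comp o_def case_prod_unfold)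

lemma result_bind [simp]:
  "result orc (bind_alg A g) = bind_pmf (result orc A) (\<lambda>v. result orc (g v))"
  by (simp add: result_def run_bind map_bind_pmf bind_map_pmf pmf.map_comp o_def case_prod_unfold)

lemma result_repeat: "result orc (repeat_alg n A) = iid_sum n (result orc A)"
  by (induction n) (simp_all add: map_pmf_def)

text \<open>Both sides follow the same random choices. Truncation thus acts as a function on the
  output and query count of the unlimited run, whose moments are easier to compute.\<close>

lemma result_limit:
  "result orc (limit_alg b A n) = map_pmf (\<lambda>(v, q). if q \<le> n then v else b) (run orc A)"
proof (induction A arbitrary: n)
  case (Sample p f)
  thus ?case by (simp add: map_bind_pmf)
next
  case (Query S f)
  show ?case
  proof (cases n)
    case 0
    have "map_pmf (\<lambda>(v, q). if q \<le> 0 then v else b) (run orc (Query S f)) 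
        = bind_pmf (orc S) (\<lambda>i. map_pmf (\<lambda>_. b) (run orc (f i)))"
      by (simp add: map_bind_pmf pmf.map_comp o_def case_prod_unfold)
    thus ?thesis using 0 by (simp add: map_pmf_const)
  next
    case (Suc k)
    have "map_pmf (\<lambda>(v, q). if q \<le> n then v else b) (run orc (Query S f))
        = bind_pmf (orc S) (\<lambda>i. map_pmf (\<lambda>(v, q). if q \<le> k then v else b) (run orc (f i)))"
      by (simp add: Suc map_bind_pmf pmf.map_comp o_def case_prod_unfold cong: if_cong)
    thus ?thesis using Suc Query.IH by simp
  qed
qed simp

text \<open>With \<open>n = m\<close>, more than \<open>2 * m\<close> queries force a total above
  \<open>m\<close>; this is what makes the truncation in \<open>ratio_alg\<close> harmless.\<close>

lemma run_repeat_queries: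
  assumes "\<And>v q. (v, q) \<in> set_pmf (run orc A) \<Longrightarrow> real q \<le> v + 1"
  shows "(v, q) \<in> set_pmf (run orc (repeat_alg n A)) \<Longrightarrow> real q \<le> v + n"
proof (induction n arbitrary: v q)
  case (Suc n)
  then obtain x q1 y q2 where "(x, q1) \<in> set_pmf (run orc A)"
    "(y, q2) \<in> set_pmf (run orc (repeat_alg n A))" "v = x + y" "q = q1 + q2"
    by (auto simp: run_bind)
  thus ?case using assms[of x q1] Suc.IH[of y q2] by auto
qed auto


section \<open>Random subsets\<close>

primrec random_subset :: "real \<Rightarrow> 'a list \<Rightarrow> 'a set pmf" where
  "random_subset q [] = return_pmf {}"
| "random_subset q (x # xs) = bind_pmf (bernoulli_pmf q)
     (\<lambda>b. map_pmf (\<lambda>S. if b then insert x S else S) (random_subset q xs))"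

lemma set_random_subset: "S \<in> set_pmf (random_subset q xs) \<Longrightarrow> S \<subseteq> set xs"
  by (induction xs arbitrary: S) (auto split: if_splits; blast)+

lemma finite_random_subset [intro]: "finite (set_pmf (random_subset q xs))"
  by (rule finite_subset[of _ "Pow (set xs)"]) (auto dest: set_random_subset)

text \<open>Conditions on the coin of \<open>x\<close>; \<open>g\<close> is left open so that one
  step serves both moments.\<close>

lemma random_subset_step:
  assumes "0 \<le> q" "q \<le> 1" "x \<notin> set xs"
  shows "expect (random_subset q (x # xs)) (\<lambda>S. g (sum w S))
     = q * expect (random_subset q xs) (\<lambda>S. g (w x + sum w S))
       + (1 - q) * expect (random_subset q xs) (\<lambda>S. g (sum w S))"
proof -
  have "expect (random_subset q xs) (\<lambda>S. g (sum w (insert x S)))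
      = expect (random_subset q xs) (\<lambda>S. g (w x + sum w S))"
  proof (rule expect_cong)
    fix S assume "S \<in> set_pmf (random_subset q xs)"
    from set_random_subset[OF this] have "finite S" "x \<notin> S"
      using assms by (auto intro: finite_subset)
    thus "g (sum w (insert x S)) = g (w x + sum w S)" by simp
  qed
  thus ?thesis
    using assms by (simp add: expect_bind_finite finite_random_subset)
qed

lemma random_subset_first_moment:
  fixes w :: "'a \<Rightarrow> real"
  assumes "0 \<le> q" "q \<le> 1" "distinct xs"
  shows "expect (random_subset q xs) (sum w) = q * sum w (set xs)"
  using assms(3)
proof (induction xs)
  case (Cons x xs)
  thus ?case
    using random_subset_step[OF assms(1,2), of x xs "\<lambda>t. t" w]
    by (simp add: expect_add_finite finite_random_subset algebra_simps)
qed simp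

text \<open>The terms are independent, and each has variance at most
  \<open>q * (w x)\<^sup>2\<close>, hence at most \<open>q * w x\<close> as the weights lie in the
  unit interval.\<close>

lemma random_subset_second_moment:
  fixes w :: "'a \<Rightarrow> real"
  assumes "0 \<le> q" "q \<le> 1" "distinct xs" "\<And>x. x \<in> set xs \<Longrightarrow> 0 \<le> w x \<and> w x \<le> 1"
  shows "expect (random_subset q xs) (\<lambda>S. (sum w S)\<^sup>2)
           \<le> q * sum w (set xs) + (q * sum w (set xs))\<^sup>2"
  using assms(3,4)
proof (induction xs)
  case (Cons x xs)
  define W where "W = sum w (set xs)"
  have x: "x \<notin> set xs" "distinct xs" and w: "0 \<le> w x" "w x \<le> 1" using Cons.prems by auto
  have IH: "expect (random_subset q xs) (\<lambda>S. (sum w S)\<^sup>2) \<le> q * W + (q * W)\<^sup>2"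
    using Cons by (auto simp: W_def)
  have "expect (random_subset q xs) (\<lambda>S. (w x + sum w S)\<^sup>2)
      = expect (random_subset q xs) (\<lambda>S. ((w x)\<^sup>2 + 2 * w x * sum w S) + (sum w S)\<^sup>2)"
    by (intro expect_cong) (simp add: power2_sum)
  also have "\<dots> = (w x)\<^sup>2 + 2 * w x * (q * W) + expect (random_subset q xs) (\<lambda>S. (sum w S)\<^sup>2)"
    using random_subset_first_moment[OF assms(1,2) x(2), of w]
    by (simp add: expect_add_finite finite_random_subset W_def)
  finally have "expect (random_subset q (x # xs)) (\<lambda>S. (sum w S)\<^sup>2)
      = q * (w x)\<^sup>2 + 2 * q * w x * (q * W) + expect (random_subset q xs) (\<lambda>S. (sum w S)\<^sup>2)"
    using random_subset_step[OF assms(1,2) x(1), of "\<lambda>t. t\<^sup>2" w] by (simp add: algebra_simps)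
  also have "\<dots> \<le> q * w x + 2 * q * w x * (q * W) + (q * W + (q * W)\<^sup>2)"
  proof -
    have "(w x)\<^sup>2 \<le> w x" using w by (simp add: power2_eq_square mult_left_le)
    hence "q * (w x)\<^sup>2 \<le> q * w x" using assms(1) by (rule mult_left_mono)
    thus ?thesis using IH by linarith
  qed
  also have "\<dots> \<le> q * (w x + W) + (q * (w x + W))\<^sup>2"
  proof -
    \<comment> \<open>The two sides differ by exactly this square.\<close>
    have "0 \<le> (q * w x)\<^sup>2" by simp
    thus ?thesis by (simp add: power2_eq_square algebra_simps)
  qed
  finally show ?case using x by (simp add: W_def)
qed simp

section \<open>Sampling without replacement until a given element appears\<close>

text \<open>\<open>n\<close> is fuel for the recursion. Fuel \<open>card S\<close> suffices: once
  all of \<open>S\<close> has been drawn, only \<open>i\<close> is left, so the output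
  \<open>0\<close> without a query is the correct remaining count.\<close>

primrec draw_until :: "nat \<Rightarrow> nat \<Rightarrow> nat set \<Rightarrow> cond_alg" where
  "draw_until 0 i S = Output 0"
| "draw_until (Suc n) i S = Query (insert i S)
     (\<lambda>j. if j = i then Output 0 else bind_alg (draw_until n i (S - {j})) (\<lambda>x. Output (1 + x)))"

text \<open>Every query except a final one returning \<open>i\<close> adds one to the output,
  whatever the oracle answers.\<close>

lemma draw_until_queries: "(v, q) \<in> set_pmf (run orc (draw_until n i S)) \<Longrightarrow> real q \<le> v + 1"
proof (induction n arbitrary: v q S)
  case (Suc n)
  from Suc.prems obtain j v' q' where j: "q = Suc q'"
    "(v, q') \<in> set_pmf (run orc (if j = i then Output 0
        else bind_alg (draw_until n i (S - {j})) (\<lambda>x. Output (1 + x))))"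
    by auto
  show ?case
  proof (cases "j = i")
    case True
    thus ?thesis using j by simp
  next
    case False
    then obtain x where "(x, q') \<in> set_pmf (run orc (draw_until n i (S - {j})))" "v = 1 + x"
      using j by (auto simp: run_bind)
    thus ?thesis using Suc.IH[of x q' "S - {j}"] j by simp
  qed
qed simp

lemma query_sets_draw_until:
  "insert i S \<subseteq> {1..N} \<Longrightarrow> T \<in> query_sets (draw_until n i S) \<Longrightarrow> T \<subseteq> {1..N}"
proof (induction n arbitrary: S)
  case (Suc n)
  from Suc.prems(2) consider "T = insert i S"
    | j where "T \<in> query_sets (bind_alg (draw_until n i (S - {j})) (\<lambda>x. Output (1 + x)))"
    by (auto split: if_splits)
  thus ?case
  proof cases
    case 2
    hence "T \<in> query_sets (draw_until n i (S - {j}))"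
      using query_sets_bind[of "draw_until n i (S - {j})" "\<lambda>x. Output (1 + x)"] by auto
    thus ?thesis using Suc.IH[of "S - {j}"] Suc.prems(1) by blast
  qed (use Suc.prems in auto)
qed simp

section \<open>The oracle's law and the moments of the number of draws before
  \<open>i\<close>\<close>

locale cond_oracle =
  fixes N :: nat and D :: "nat pmf" and orc :: "nat set \<Rightarrow> nat pmf"
  assumes dist: "distribution_on N D" and orc: "is_cond_oracle N D orc"
begin

abbreviation d :: "nat \<Rightarrow> real" where "d \<equiv> pmf D"

definition beaten_by :: "nat \<Rightarrow> nat \<Rightarrow> real" where
  "beaten_by i j = d j / (d i + d j)"

lemma set_D: "set_pmf D \<subseteq> {1..N}"
  using dist by (simp add: distribution_on_def)

lemma sum_d: "sum d {1..N} = 1"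
  by (rule sum_pmf_eq_1) (use set_D in auto)

text \<open>One element of positive mass places \<open>S\<close> among the queries on which the
  oracle is constrained. In the algorithms this element is the sampled index
  \<open>i\<close>.\<close>

lemma oracle_pmf:
  assumes "S \<subseteq> {1..N}" "i \<in> S" "d i > 0" "j \<in> S"
  shows "pmf (orc S) j = d j / sum d S"
proof -
  have fin: "finite S" using assms(1) finite_subset by blast
  hence "measure_pmf.prob D S = sum d S" by (rule measure_measure_pmf_finite)
  moreover have "sum d S \<ge> d i" using assms fin by (intro member_le_sum) auto
  ultimately show ?thesis using orc assms by (simp add: is_cond_oracle_def)
qed

text \<open>The oracle is specified only on elements of \<open>S\<close>, but the probabilities
  given there already sum to 1.\<close>

lemma set_oracle:
  assumes "S \<subseteq> {1..N}" "i \<in> S" "d i > 0"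
  shows "set_pmf (orc S) \<subseteq> S"
proof -
  have fin: "finite S" using assms(1) finite_subset by blast
  have "sum d S \<ge> d i" using assms fin by (intro member_le_sum) auto
  hence "(\<Sum>j\<in>S. pmf (orc S) j) = 1"
    using assms by (simp add: oracle_pmf[OF assms] flip: sum_divide_distrib)
  hence "measure_pmf.prob (orc S) S = 1" using fin by (simp add: measure_measure_pmf_finite)
  thus ?thesis by (simp add: measure_pmf.prob_eq_1 AE_measure_pmf_iff subset_iff)
qed

lemma expect_oracle:
  assumes "S \<subseteq> {1..N}" "i \<in> S" "d i > 0"
  shows "expect (orc S) h = (\<Sum>j\<in>S. h j * d j) / sum d S"
proof -
  have fin: "finite S" using assms(1) finite_subset by blast
  have "expect (orc S) h = (\<Sum>j\<in>S. h j * pmf (orc S) j)"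
    using set_oracle[OF assms] fin by (intro integral_measure_pmf_real) auto
  thus ?thesis by (simp add: oracle_pmf[OF assms] sum_divide_distrib)
qed

lemma finite_oracle:
  assumes "S \<subseteq> {1..N}" "i \<in> S" "d i > 0"
  shows "finite (set_pmf (orc S))"
  using set_oracle[OF assms] assms(1) by (meson finite_atLeastAtMost finite_subset)

lemma expect_full: "expect (orc {1..N}) h = (\<Sum>j=1..N. h j * d j)"
proof -
  obtain i where "i \<in> set_pmf D" by (meson set_pmf_not_empty ex_in_conv)
  hence "i \<in> {1..N}" "d i > 0" using set_D by (auto simp: pmf_positive)
  from expect_oracle[OF order.refl this] show ?thesis by (simp only: sum_d div_by_1)
qed

text \<open>Ensures that a sampled index has positive mass, on which all later queries containing it
  rely.\<close>

lemma set_full: "set_pmf (orc {1..N}) \<subseteq> set_pmf D"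
proof -
  obtain i where "i \<in> set_pmf D" by (meson set_pmf_not_empty ex_in_conv)
  hence i: "i \<in> {1..N}" "d i > 0" using set_D by (auto simp: pmf_positive)
  show ?thesis
  proof
    fix j assume j: "j \<in> set_pmf (orc {1..N})"
    hence "j \<in> {1..N}" using set_oracle[OF order.refl i] by auto
    moreover have "pmf (orc {1..N}) j \<noteq> 0" using j by (simp add: set_pmf_iff)
    ultimately show "j \<in> set_pmf D"
      using oracle_pmf[OF order.refl i, of j] by (auto simp: set_pmf_iff)
  qed
qed

lemma draw_until_finite:
  assumes "insert i S \<subseteq> {1..N}" "d i > 0"
  shows "finite (set_pmf (result orc (draw_until n i S)))
    \<and> (\<forall>x\<in>set_pmf (result orc (draw_until n i S)). 0 \<le> x)"
  using assms(1)
proof (induction n arbitrary: S)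
  case (Suc n)
  have "insert i (S - {j}) \<subseteq> {1..N}" for j using Suc.prems by auto
  note IH = Suc.IH[OF this]
  have fin: "finite (set_pmf (orc (insert i S)))"
    by (rule finite_oracle[OF Suc.prems _ assms(2)]) simp
  have "finite (set_pmf (result orc (if j = i then Output 0
           else bind_alg (draw_until n i (S - {j})) (\<lambda>x. Output (1 + x)))))" for j
    using IH[of j] by simp
  moreover have "0 \<le> x" if "x \<in> set_pmf (result orc (if j = i then Output 0
           else bind_alg (draw_until n i (S - {j})) (\<lambda>x. Output (1 + x))))" for j x
    using IH[of j] that by (auto split: if_splits)
  ultimately show ?case using fin by (simp del: result_bind)
qed simp

text \<open>Conditions on the first response: \<open>i\<close> ends the count, while
  \<open>j\<close> in \<open>S\<close> adds one and leaves the same problem for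
  \<open>S - {j}\<close>.\<close>

lemma draw_until_step:
  assumes "insert i S \<subseteq> {1..N}" "d i > 0" "i \<notin> S"
  shows "expect (result orc (draw_until (Suc n) i S)) h
    = (h 0 * d i + (\<Sum>j\<in>S. expect (result orc (draw_until n i (S - {j}))) (\<lambda>x. h (1 + x)) * d j))
        / (d i + sum d S)"
proof -
  have fS: "finite S" using assms(1) by (auto intro: finite_subset)
  define A where "A j = (if j = i then Output 0
           else bind_alg (draw_until n i (S - {j})) (\<lambda>x. Output (1 + x)))" for j
  have "insert i (S - {j}) \<subseteq> {1..N}" for j using assms by auto
  from draw_until_finite[OF this assms(2)]
  have finA: "finite (set_pmf (result orc (draw_until n i (S - {j}))))" for j by auto
  hence "finite (set_pmf (result orc (A j)))" for j by (simp add: A_def)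
  hence "expect (result orc (draw_until (Suc n) i S)) h
      = expect (orc (insert i S)) (\<lambda>j. expect (result orc (A j)) h)"
    using finite_oracle[OF assms(1) _ assms(2)] by (simp add: A_def expect_bind_finite)
  also have "\<dots> = (\<Sum>j\<in>insert i S. expect (result orc (A j)) h * d j) / sum d (insert i S)"
    by (rule expect_oracle[OF assms(1) _ assms(2)]) simp
  also have "(\<Sum>j\<in>insert i S. expect (result orc (A j)) h * d j)
      = h 0 * d i + (\<Sum>j\<in>S. expect (result orc (A j)) h * d j)"
    using fS assms(3) by (simp add: A_def)
  also have "(\<Sum>j\<in>S. expect (result orc (A j)) h * d j)
      = (\<Sum>j\<in>S. expect (result orc (draw_until n i (S - {j}))) (\<lambda>x. h (1 + x)) * d j)"
    using assms(3) finA by (intro sum.cong refl) (auto simp: A_def expect_bind_finite)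
  finally show ?thesis using fS assms(3) by simp
qed

text \<open>
  Before \<open>i\<close> appears, \<open>j\<close> is drawn with probability \<open>d j / (d i + d j)\<close>, whatever
  other elements \<open>S\<close> contains.
\<close>
lemma draw_until_first_moment:
  assumes "insert i S \<subseteq> {1..N}" "d i > 0" "i \<notin> S" "card S \<le> n"
  shows "expect (result orc (draw_until n i S)) (\<lambda>x. x) = sum (beaten_by i) S"
  using assms(1,3,4)
proof (induction n arbitrary: S)
  case 0
  hence "S = {}" using finite_subset[of S "{1..N}"] by auto
  thus ?case by simp
next
  case (Suc n)
  have fS: "finite S" using Suc.prems by (auto intro: finite_subset)
  define T where "T = d i + sum d S"
  have T: "T > 0" using assms(2) sum_nonneg[of S d] by (simp add: T_def add_pos_nonneg)
  have "expect (result orc (draw_until n i (S - {j}))) (\<lambda>x. 1 + x) = 1 + (sum (beaten_by i) S - beaten_by i j)"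
    if j: "j \<in> S" for j
  proof -
    have sub: "insert i (S - {j}) \<subseteq> {1..N}" using Suc.prems by auto
    have "expect (result orc (draw_until n i (S - {j}))) (\<lambda>x. x) = sum (beaten_by i) (S - {j})"
      using Suc.prems j fS by (intro Suc.IH) auto
    thus ?thesis
      using draw_until_finite[OF sub assms(2), of n] fS j
      by (simp add: expect_add_finite sum_diff1)
  qed
  hence "T * expect (result orc (draw_until (Suc n) i S)) (\<lambda>x. x)
     = (\<Sum>j\<in>S. (1 + (sum (beaten_by i) S - beaten_by i j)) * d j)"
    using draw_until_step[OF Suc.prems(1) assms(2) Suc.prems(2), of n "\<lambda>x. x"] T
    by (simp add: T_def)
  \<comment> \<open>With \<open>p = beaten_by i j\<close>, the identity
    \<open>(1 - p) * d j = p * d i\<close> makes the whole sum factor through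
    \<open>T\<close>.\<close>
  also have "\<dots> = (\<Sum>j\<in>S. sum (beaten_by i) S * d j + beaten_by i j * d i)"
  proof (intro sum.cong refl)
    fix j assume "j \<in> S"
    have "d i + d j > 0" using assms(2) by (auto intro: add_pos_nonneg)
    hence "d j = beaten_by i j * (d i + d j)" by (simp add: beaten_by_def)
    thus "(1 + (sum (beaten_by i) S - beaten_by i j)) * d j = sum (beaten_by i) S * d j + beaten_by i j * d i"
      by (simp add: algebra_simps)
  qed
  also have "\<dots> = T * sum (beaten_by i) S"
    by (simp add: sum.distrib T_def algebra_simps flip: sum_distrib_left sum_distrib_right)
  finally show ?case using T by simp
qed

lemma beaten_by_bounds: "0 \<le> beaten_by i j" "beaten_by i j \<le> 1"
proof -
  have nn: "0 \<le> d i" "0 \<le> d j" by auto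
  show "0 \<le> beaten_by i j" unfolding beaten_by_def using nn by simp
  show "beaten_by i j \<le> 1"
  proof (cases "d i + d j = 0")
    case False
    hence "d i + d j > 0" using nn by linarith
    thus ?thesis using nn by (simp add: beaten_by_def)
  qed (simp add: beaten_by_def)
qed

text \<open>The bound is the second moment of a geometric variable with the same mean, counting
  failures before the first success. The induction conditions on the first draw and uses the exact
  first moment for the linear term.\<close>

lemma draw_until_second_moment:
  assumes "insert i S \<subseteq> {1..N}" "d i > 0" "i \<notin> S" "card S \<le> n"
  shows "expect (result orc (draw_until n i S)) (\<lambda>x. x\<^sup>2)
           \<le> sum (beaten_by i) S + 2 * (sum (beaten_by i) S)\<^sup>2"
  using assms(1,3,4)
proof (induction n arbitrary: S)
  case 0
  hence "S = {}" using finite_subset[of S "{1..N}"] by auto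
  thus ?case by simp
next
  case (Suc n)
  have fS: "finite S" using Suc.prems by (auto intro: finite_subset)
  define P where "P = sum (beaten_by i) S"
  define T where "T = d i + sum d S"
  have P: "P \<ge> 0" unfolding P_def by (intro sum_nonneg beaten_by_bounds)
  have T: "T > 0" using assms(2) sum_nonneg[of S d] by (simp add: T_def add_pos_nonneg)
  have dj: "d j = beaten_by i j * (d i + d j)" for j
  proof -
    have "d i + d j > 0" using assms(2) by (auto intro: add_pos_nonneg)
    thus ?thesis by (simp add: beaten_by_def)
  qed
  \<comment> \<open>The coefficient 3 collects twice the mean from the square and once the mean from
    the induction hypothesis.\<close>
  have "expect (result orc (draw_until n i (S - {j}))) (\<lambda>x. (1 + x)\<^sup>2)
           \<le> 1 + 3 * (P - beaten_by i j) + 2 * (P - beaten_by i j)\<^sup>2"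
    if j: "j \<in> S" for j
  proof -
    have sub: "insert i (S - {j}) \<subseteq> {1..N}" using Suc.prems by auto
    have "card (S - {j}) \<le> n" using Suc.prems j fS by simp
    note * = draw_until_first_moment[OF sub assms(2) _ this] Suc.IH[OF sub _ this]
    have "expect (result orc (draw_until n i (S - {j}))) (\<lambda>x. (1 + x)\<^sup>2)
        = expect (result orc (draw_until n i (S - {j}))) (\<lambda>x. (1 + 2 * x) + x\<^sup>2)"
      by (intro expect_cong) (simp add: power2_sum)
    also have "\<dots> \<le> 1 + 3 * (P - beaten_by i j) + 2 * (P - beaten_by i j)\<^sup>2"
      using draw_until_finite[OF sub assms(2), of n] fS j * Suc.prems
      by (simp add: expect_add_finite sum_diff1 P_def)
    finally show ?thesis .
  qed
  hence "T * expect (result orc (draw_until (Suc n) i S)) (\<lambda>x. x\<^sup>2)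
     \<le> (\<Sum>j\<in>S. (1 + 3 * (P - beaten_by i j) + 2 * (P - beaten_by i j)\<^sup>2) * d j)"
    using draw_until_step[OF Suc.prems(1) assms(2) Suc.prems(2), of n "\<lambda>x. x\<^sup>2"] T
    by (auto simp: T_def intro!: sum_mono mult_right_mono)
  \<comment> \<open>For \<open>p = beaten_by i j\<close>, the product \<open>p * d j\<close> is
    rewritten as \<open>d j - d i * p\<close>.\<close>
  also have "\<dots> = (\<Sum>j\<in>S. (1 + 3 * P + 2 * P\<^sup>2) * d j - (3 + 4 * P) * (d j - d i * beaten_by i j)
      + 2 * beaten_by i j * (d j - d i * beaten_by i j))"
  proof (intro sum.cong refl)
    fix j
    define p where "p = beaten_by i j"
    have e: "d j - d i * p = p * d j" using dj[of j] unfolding p_def[symmetric] by (simp add: algebra_simps)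
    have "(1 + 3 * (P - p) + 2 * (P - p)\<^sup>2) * d j
        = (1 + 3 * P + 2 * P\<^sup>2) * d j - (3 + 4 * P) * (p * d j) + 2 * p * (p * d j)"
      by (simp add: power2_eq_square algebra_simps)
    thus "(1 + 3 * (P - beaten_by i j) + 2 * (P - beaten_by i j)\<^sup>2) * d j
        = (1 + 3 * P + 2 * P\<^sup>2) * d j - (3 + 4 * P) * (d j - d i * beaten_by i j)
          + 2 * beaten_by i j * (d j - d i * beaten_by i j)"
      by (simp only: e flip: p_def)
  qed
  \<comment> \<open>Bounding the one remaining quadratic factor \<open>beaten_by i j\<close> by 1
    leaves terms that sum to expressions in \<open>P\<close> and \<open>T\<close>.\<close>
  also have "\<dots> \<le> (\<Sum>j\<in>S. (1 + 3 * P + 2 * P\<^sup>2) * d j - (3 + 4 * P) * (d j - d i * beaten_by i j)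
      + 2 * (d j - d i * beaten_by i j))"
  proof (intro sum_mono add_left_mono)
    fix j
    have "d j - d i * beaten_by i j = beaten_by i j * d j"
      using dj[of j] by (simp add: algebra_simps)
    hence "0 \<le> d j - d i * beaten_by i j" by (simp add: beaten_by_bounds)
    thus "2 * beaten_by i j * (d j - d i * beaten_by i j) \<le> 2 * (d j - d i * beaten_by i j)"
      using beaten_by_bounds[of i j] by (intro mult_right_mono) auto
  qed
  also have "\<dots> = (\<Sum>j\<in>S. d j * (2 * P\<^sup>2 - P)) + (\<Sum>j\<in>S. d i * (1 + 4 * P) * beaten_by i j)"
    unfolding sum.distrib[symmetric] by (intro sum.cong refl) (simp add: algebra_simps)
  also have "\<dots> = (T - d i) * (2 * P\<^sup>2 - P) + d i * (1 + 4 * P) * P"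
    by (simp add: T_def P_def flip: sum_distrib_left sum_distrib_right)
  \<comment> \<open>After cancellation the claim is \<open>P * (d i * P + d i) \<le> P * T\<close>,
    which follows from \<open>d i * beaten_by i j \<le> d j\<close>.\<close>
  also have "\<dots> \<le> T * (P + 2 * P\<^sup>2)"
  proof -
    have "d i * P = (\<Sum>j\<in>S. d j - beaten_by i j * d j)"
      unfolding P_def sum_distrib_left
      by (intro sum.cong refl) (use dj in \<open>simp add: algebra_simps\<close>)
    also have "\<dots> \<le> sum d S" by (intro sum_mono) (simp add: beaten_by_bounds)
    finally have "d i * P + d i \<le> T" by (simp add: T_def)
    hence "P * (d i * P + d i) \<le> P * T" using P by (intro mult_left_mono)
    thus ?thesis by (simp add: power2_eq_square algebra_simps)
  qed
  finally show ?case using T by (simp add: P_def)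
qed

end


section \<open>The estimator\<close>

text \<open>The inner test keeps every query inside \<open>{1..N}\<close> even on branches of
  probability zero, as \<open>query_sets\<close> ranges over all responses; \<open>trial_alg\<close>
  has the same guard.\<close>

definition comparison_alg :: "nat \<Rightarrow> nat \<Rightarrow> cond_alg" where
  "comparison_alg N i = Query {1..N}
     (\<lambda>j. if j \<in> {1..N} then Query {i, j} (\<lambda>k. Output (if k = i then 1 else 0)) else Output 0)"

text \<open>\<open>Sample\<close> draws natural numbers, so the subset travels as a code. The
  intersection and the removal of \<open>i\<close> only matter for codes outside the
  support.\<close>

definition count_alg :: "nat \<Rightarrow> real \<Rightarrow> nat \<Rightarrow> cond_alg" where
  "count_alg N \<tau> i = Sample (map_pmf set_encode (random_subset \<tau> (filter (\<lambda>j. j \<noteq> i) [1..<Suc N])))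
     (\<lambda>c. draw_until N i (set_decode c \<inter> {1..N} - {i}))"

text \<open>
  The limit on the number of queries never changes the output: once more than \<open>2 * m\<close> queries
  are needed, the true count exceeds \<open>m\<close>, and then the minimum is attained by \<open>1\<close>
  (or the quotient is \<open>0\<close> because \<open>y = 0\<close>).
\<close>
definition ratio_alg :: "nat \<Rightarrow> real \<Rightarrow> nat \<Rightarrow> nat \<Rightarrow> cond_alg" where
  "ratio_alg N \<tau> m i = bind_alg (repeat_alg m (comparison_alg N i))
     (\<lambda>y. bind_alg (limit_alg m (repeat_alg m (count_alg N \<tau> i)) (2 * m))
       (\<lambda>x. Output (min 1 ((\<tau> + x / m) / (y / m)))))"

definition trial_alg :: "nat \<Rightarrow> nat pmf \<Rightarrow> nat \<Rightarrow> cond_alg" where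
  "trial_alg N Dstar m = Query {1..N}
     (\<lambda>i. if i \<in> {1..N} then ratio_alg N (pmf Dstar i) m i else Output 0)"

definition tv_alg :: "nat \<Rightarrow> nat pmf \<Rightarrow> nat \<Rightarrow> nat \<Rightarrow> cond_alg" where
  "tv_alg N Dstar m n = bind_alg (repeat_alg n (trial_alg N Dstar m)) (\<lambda>z. Output (1 - z / n))"

section \<open>Query counts and admissibility of the queried sets\<close>

lemma queries_le_ratio: "queries_le (ratio_alg N \<tau> m i) (4 * m)"
proof -
  have "queries_le (comparison_alg N i) 2" by (simp add: comparison_alg_def)
  hence "queries_le (ratio_alg N \<tau> m i) (m * 2 + (2 * m + 0))"
    unfolding ratio_alg_def
    by (intro queries_le_bind queries_le_repeat queries_le_limit) auto
  thus ?thesis by (simp add: mult.commute)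
qed

lemma queries_le_tv: "queries_le (tv_alg N Dstar m n) (n * (4 * m + 1))"
proof -
  have "queries_le (trial_alg N Dstar m) (4 * m + 1)"
    by (simp add: trial_alg_def queries_le_ratio)
  hence "queries_le (tv_alg N Dstar m n) (n * (4 * m + 1) + 0)"
    unfolding tv_alg_def by (intro queries_le_bind queries_le_repeat) auto
  thus ?thesis by simp
qed

lemma query_sets_ratio:
  assumes "i \<in> {1..N}"
  shows "query_sets (ratio_alg N \<tau> m i) \<subseteq> Pow {1..N}"
proof -
  have "query_sets (comparison_alg N i) \<subseteq> Pow {1..N}"
    using assms by (auto simp: comparison_alg_def split: if_splits)
  moreover have "query_sets (count_alg N \<tau> i) \<subseteq> Pow {1..N}"
  proof -
    have "query_sets (draw_until N i (set_decode c \<inter> {1..N} - {i})) \<subseteq> Pow {1..N}" for c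
      using query_sets_draw_until[of i "set_decode c \<inter> {1..N} - {i}" N] assms by auto
    thus ?thesis by (auto simp: count_alg_def)
  qed
  moreover have "query_sets (ratio_alg N \<tau> m i)
     \<subseteq> query_sets (comparison_alg N i) \<union> query_sets (count_alg N \<tau> i)"
  proof -
    have "query_sets (bind_alg (limit_alg m (repeat_alg m (count_alg N \<tau> i)) (2 * m))
       (\<lambda>x. Output (min 1 ((\<tau> + x / m) / (y / m))))) \<subseteq> query_sets (count_alg N \<tau> i)" for y
      using query_sets_bind[of "limit_alg m (repeat_alg m (count_alg N \<tau> i)) (2 * m)"
          "\<lambda>x. Output (min 1 ((\<tau> + x / m) / (y / m)))"]
        query_sets_limit[of m "repeat_alg m (count_alg N \<tau> i)" "2 * m"]
        query_sets_repeat[of m "count_alg N \<tau> i"]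
      by simp
    thus ?thesis
      unfolding ratio_alg_def
      using query_sets_bind[of "repeat_alg m (comparison_alg N i)"]
        query_sets_repeat[of m "comparison_alg N i"] by blast
  qed
  ultimately show ?thesis by blast
qed

lemma query_sets_tv: "query_sets (tv_alg N Dstar m n) \<subseteq> Pow {1..N}"
proof -
  have "query_sets (if i \<in> {1..N} then ratio_alg N (pmf Dstar i) m i else Output 0) \<subseteq> Pow {1..N}" for i
    using query_sets_ratio by simp
  hence "query_sets (trial_alg N Dstar m) \<subseteq> Pow {1..N}"
    unfolding trial_alg_def by auto
  thus ?thesis
    using query_sets_bind[of "repeat_alg n (trial_alg N Dstar m)" "\<lambda>z. Output (1 - z / n)"]
      query_sets_repeat[of n "trial_alg N Dstar m"]
    unfolding tv_alg_def by simp
qed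

section \<open>Real inequalities: capped ratios and sums over partial sums\<close>

lemma abs_min_diff_le: "\<bar>min a b - min c d\<bar> \<le> \<bar>a - c\<bar> + \<bar>b - d\<bar>"
  for a b c d :: real
  by (smt (verit))

text \<open>Multiplying the capped ratio \<open>s\<close> by its denominator gives
  \<open>min y x\<close>, which is 1-Lipschitz in each argument. The second copy of
  \<open>\<bar>y' - y\<bar>\<close> pays for the change of denominator, using
  \<open>s' \<le> 1\<close>.\<close>

lemma min_ratio_error_aux:
  fixes x y x' y' :: real
  assumes "y > 0" "x \<ge> 0" "x' \<ge> 0" "y' \<ge> 0"
  shows "\<bar>min 1 (x' / y') - min 1 (x / y)\<bar> \<le> (2 * \<bar>y' - y\<bar> + \<bar>x' - x\<bar>) / y"
proof -
  define s s' where "s = min 1 (x / y)" and "s' = min 1 (x' / y')"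
  have s: "y * s = min y x"
    using assms(1) by (auto simp: s_def min_def field_simps)
  have s': "y' * s' = min y' x'" if "y' > 0"
    using that by (auto simp: s'_def min_def field_simps)
  \<comment> \<open>\<open>y' = 0\<close> occurs when no comparison returns \<open>i\<close>; both
    sides are then \<open>0\<close>.\<close>
  have s'': "y' * s' = min y' x'"
    using s' assms by (cases "y' = 0") auto
  have b: "0 \<le> s'" "s' \<le> 1" using assms by (auto simp: s'_def)
  have "y * (s' - s) = s' * (y - y') + (min y' x' - min y x)"
    unfolding s[symmetric] s''[symmetric] by (simp add: algebra_simps)
  also have "\<bar>\<dots>\<bar> \<le> 1 * \<bar>y - y'\<bar> + (\<bar>y' - y\<bar> + \<bar>x' - x\<bar>)"
  proof -
    have "\<bar>s' * (y - y')\<bar> \<le> 1 * \<bar>y - y'\<bar>"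
      unfolding abs_mult using b by (intro mult_right_mono) auto
    moreover have "\<bar>min y' x' - min y x\<bar> \<le> \<bar>y' - y\<bar> + \<bar>x' - x\<bar>"
      by (rule abs_min_diff_le)
    ultimately show ?thesis by (rule order.trans[OF abs_triangle_ineq add_mono])
  qed
  finally have "y * \<bar>s' - s\<bar> \<le> 2 * \<bar>y' - y\<bar> + \<bar>x' - x\<bar>"
    using assms(1) by (simp add: abs_mult abs_minus_commute)
  thus ?thesis using assms(1) by (simp add: s_def s'_def field_simps)
qed

text \<open>
  When \<open>x > y\<close>, the error in \<open>x'\<close> is damped by \<open>y / x\<close>: scaling \<open>x\<close> and \<open>x'\<close> down by this
  factor leaves the second minimum equal to \<open>1\<close> and can only decrease the first one.
\<close>
lemma min_ratio_error:
  fixes x y x' y' :: real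
  assumes "y > 0" "x \<ge> 0" "x' \<ge> 0" "y' \<ge> 0"
  shows "\<bar>min 1 (x' / y') - min 1 (x / y)\<bar>
           \<le> (2 * \<bar>y' - y\<bar> + (if x \<le> y then 1 else y / x) * \<bar>x' - x\<bar>) / y"
proof (cases "x \<le> y")
  case True
  thus ?thesis using min_ratio_error_aux[OF assms] by simp
next
  case False
  hence x: "x > y" "x > 0" using assms by auto
  define x'' where "x'' = x' * (y / x)"
  have x'': "0 \<le> x''" "x'' \<le> x'"
    unfolding x''_def using x assms by (simp, intro mult_left_le) auto
  have "\<bar>min 1 (x' / y') - min 1 (x / y)\<bar> = 1 - min 1 (x' / y')"
    using x assms by (simp add: min_def)
  also have "\<dots> \<le> \<bar>min 1 (x'' / y') - min 1 (y / y)\<bar>"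
  proof -
    have "x'' / y' \<le> x' / y'" using x'' assms by (intro divide_right_mono) auto
    thus ?thesis using assms by auto
  qed
  also have "\<dots> \<le> (2 * \<bar>y' - y\<bar> + \<bar>x'' - y\<bar>) / y"
    using assms x'' by (intro min_ratio_error_aux) auto
  also have "x'' - y = (y / x) * (x' - x)"
    using x by (simp add: x''_def field_simps)
  finally show ?thesis using False x assms by (simp add: abs_mult)
qed

text \<open>A Riemann sum for the integral of \<open>1 / sqrt t\<close> from \<open>0\<close> to
  \<open>sum d B\<close>. Elements are added in increasing order of \<open>d\<close>, so the partial
  sum at the new element is the full sum so far.\<close>

lemma sum_div_sqrt_partial_sums:
  fixes d :: "'a \<Rightarrow> real"
  assumes "finite B" "\<And>i. d i \<ge> 0"
  shows "(\<Sum>i\<in>B. d i / sqrt (sum d {j\<in>B. d j \<le> d i})) \<le> 2 * sqrt (sum d B)"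
  using assms(1)
proof (induction B rule: finite_ranking_induct[where f = d])
  case (insert x S)
  show ?case
  proof (cases "x \<in> S")
    case True
    thus ?thesis using insert by (simp add: insert_absorb)
  next
    case False
    define T where "T = sum d S"
    have T: "T \<ge> 0" unfolding T_def by (intro sum_nonneg assms)
    \<comment> \<open>A tie \<open>d x = d i\<close> may enlarge an earlier partial sum, which only
      decreases the term.\<close>
    have le: "d i / sqrt (sum d {j\<in>insert x S. d j \<le> d i}) \<le> d i / sqrt (sum d {j\<in>S. d j \<le> d i})"
      if "i \<in> S" for i
    proof (cases "d i = 0")
      case False
      hence "0 < d i" using assms(2)[of i] by simp
      also have "d i \<le> sum d {j\<in>S. d j \<le> d i}"
        using insert.hyps that by (intro member_le_sum assms) auto
      finally have pos: "0 < sum d {j\<in>S. d j \<le> d i}" .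
      have "sum d {j\<in>S. d j \<le> d i} \<le> sum d {j\<in>insert x S. d j \<le> d i}"
        using insert.hyps by (intro sum_mono2 assms) auto
      thus ?thesis using pos assms(2)[of i] by (intro divide_left_mono) auto
    qed simp
    have "{j\<in>insert x S. d j \<le> d x} = insert x S" using insert.hyps by auto
    hence "(\<Sum>i\<in>insert x S. d i / sqrt (sum d {j\<in>insert x S. d j \<le> d i}))
        = d x / sqrt (d x + T) + (\<Sum>i\<in>S. d i / sqrt (sum d {j\<in>insert x S. d j \<le> d i}))"
      using insert.hyps False by (simp add: T_def)
    also have "\<dots> \<le> d x / sqrt (d x + T) + 2 * sqrt T"
    proof -
      have "(\<Sum>i\<in>S. d i / sqrt (sum d {j\<in>insert x S. d j \<le> d i}))
          \<le> (\<Sum>i\<in>S. d i / sqrt (sum d {j\<in>S. d j \<le> d i}))"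
        by (intro sum_mono le)
      thus ?thesis using insert.IH unfolding T_def by linarith
    qed
    also have "\<dots> \<le> 2 * sqrt (d x + T)"
    proof (cases "d x + T = 0")
      case True
      thus ?thesis using T assms(2)[of x] by auto
    next
      case False
      \<comment> \<open>With these roots, the claim is \<open>(u - v)\<^sup>2 \<ge> 0\<close>
        divided by \<open>u\<close>.\<close>
      define u v where "u = sqrt (d x + T)" and "v = sqrt T"
      have uv: "u > 0" "v \<ge> 0" "d x = u\<^sup>2 - v\<^sup>2"
        using False T assms(2)[of x] by (auto simp: u_def v_def)
      have "u\<^sup>2 - v\<^sup>2 + 2 * v * u \<le> 2 * u * u"
        using sum_power2_ge_zero[of "u - v" 0] by (simp add: power2_eq_square algebra_simps)
      hence "(u\<^sup>2 - v\<^sup>2) / u + 2 * v \<le> 2 * u" using uv(1) by (simp add: field_simps)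
      thus ?thesis unfolding uv(3)[symmetric] unfolding u_def v_def .
    qed
    finally show ?thesis using insert.hyps False by (simp add: T_def)
  qed
qed simp

section \<open>The probability of winning a comparison\<close>

context cond_oracle
begin

text \<open>The mean output of \<open>comparison_alg\<close>. The case \<open>j = i\<close> is
  separate because a query of \<open>{i}\<close> returns \<open>i\<close> surely, whereas the
  quotient would be one half.\<close>

definition win :: "nat \<Rightarrow> real" where
  "win i = (\<Sum>j=1..N. (if j = i then 1 else d i / (d i + d j)) * d j)"

text \<open>The identity behind the estimator: multiplied by \<open>\<tau> / d i\<close>, the right
  side becomes \<open>\<tau>\<close> plus the mean count, so the quotient of the two means is
  \<open>\<tau> / d i\<close>.\<close>

lemma win_eq:
  assumes "i \<in> {1..N}"
  shows "win i = d i * (1 + sum (beaten_by i) ({1..N} - {i}))"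
proof -
  have "win i = d i + (\<Sum>j\<in>{1..N} - {i}. (if j = i then 1 else d i / (d i + d j)) * d j)"
    unfolding win_def using assms by (subst sum.remove[of _ i]) auto
  also have "(\<Sum>j\<in>{1..N} - {i}. (if j = i then 1 else d i / (d i + d j)) * d j)
      = (\<Sum>j\<in>{1..N} - {i}. d i * beaten_by i j)"
    by (intro sum.cong) (auto simp: beaten_by_def)
  finally show ?thesis by (simp add: sum_distrib_left algebra_simps)
qed

lemma win_pos: "i \<in> {1..N} \<Longrightarrow> d i > 0 \<Longrightarrow> win i > 0"
  unfolding win_eq by (intro mult_pos_pos add_pos_nonneg sum_nonneg beaten_by_bounds) auto

lemma win_le_1: "win i \<le> 1"
proof -
  have "win i \<le> (\<Sum>j=1..N. d j)"
    unfolding win_def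
  proof (intro sum_mono)
    fix j
    have h: "d i / (d i + d j) \<le> 1"
      by (cases "d i + d j = 0") (auto simp: divide_le_eq_1 add_nonneg_pos add_pos_nonneg less_le)
    thus "(if j = i then 1 else d i / (d i + d j)) * d j \<le> d j"
      using mult_right_mono[OF h, of "d j"] by (cases "j = i") simp_all
  qed
  thus ?thesis unfolding sum_d .
qed

text \<open>Against an element that is no heavier, \<open>i\<close> wins with probability at least
  one half.\<close>

lemma win_ge:
  assumes "i \<in> {1..N}" "d i > 0"
  shows "win i \<ge> sum d {j\<in>{1..N}. d j \<le> d i} / 2"
proof -
  have "sum d {j\<in>{1..N}. d j \<le> d i} / 2 = (\<Sum>j\<in>{j\<in>{1..N}. d j \<le> d i}. 1 / 2 * d j)"
    by (simp add: sum_divide_distrib)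
  also have "\<dots> \<le> (\<Sum>j\<in>{j\<in>{1..N}. d j \<le> d i}. (if j = i then 1 else d i / (d i + d j)) * d j)"
  proof (intro sum_mono mult_right_mono)
    fix j assume j: "j \<in> {j\<in>{1..N}. d j \<le> d i}"
    have "d i + d j > 0" using assms(2) by (auto intro: add_pos_nonneg)
    thus "1 / 2 \<le> (if j = i then 1 else d i / (d i + d j))"
      using j by (auto simp: field_simps)
  qed auto
  also have "\<dots> \<le> win i"
    unfolding win_def by (intro sum_mono2) (auto intro!: mult_nonneg_nonneg)
  finally show ?thesis .
qed

text \<open>Bounds the average of \<open>1 / sqrt (win i)\<close> over \<open>i\<close> drawn from
  \<open>D\<close>, independently of \<open>N\<close>, although single terms can be arbitrarily
  large.\<close>

lemma sum_d_div_sqrt_win: "(\<Sum>i=1..N. d i / sqrt (win i)) \<le> 2 * sqrt 2"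
proof -
  have "d i / sqrt (win i) \<le> sqrt 2 * (d i / sqrt (sum d {j\<in>{1..N}. d j \<le> d i}))"
    if i: "i \<in> {1..N}" for i
  proof (cases "d i = 0")
    case False
    hence di: "d i > 0" by (simp add: less_le)
    define G where "G = sum d {j\<in>{1..N}. d j \<le> d i}"
    have "d i \<le> G" unfolding G_def using i by (intro member_le_sum) auto
    hence G: "G > 0" using di by simp
    have "sqrt (G / 2) \<le> sqrt (win i)" using win_ge[OF i di] by (simp add: G_def)
    hence "d i / sqrt (win i) \<le> d i / sqrt (G / 2)"
      using di G by (intro divide_left_mono) (auto intro!: mult_pos_pos win_pos i)
    also have "\<dots> = sqrt 2 * (d i / sqrt G)" by (simp add: real_sqrt_divide)
    finally show ?thesis by (simp add: G_def)
  qed simp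
  hence "(\<Sum>i=1..N. d i / sqrt (win i))
       \<le> sqrt 2 * (\<Sum>i=1..N. d i / sqrt (sum d {j\<in>{1..N}. d j \<le> d i}))"
    unfolding sum_distrib_left by (intro sum_mono)
  also have "(\<Sum>i=1..N. d i / sqrt (sum d {j\<in>{1..N}. d j \<le> d i})) \<le> 2 * sqrt (sum d {1..N})"
    by (rule sum_div_sqrt_partial_sums) auto
  also have "sqrt (sum d {1..N}) = 1" unfolding sum_d by simp
  finally show ?thesis by simp
qed

section \<open>Moments of the two subroutines and the bias of their ratio\<close>

lemma result_comparison:
  assumes "i \<in> {1..N}" "d i > 0"
  defines "R \<equiv> result orc (comparison_alg N i)"
  shows "finite (set_pmf R)" "\<And>x. x \<in> set_pmf R \<Longrightarrow> x = 0 \<or> x = 1" "expect R (\<lambda>x. x) = win i"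
proof -
  have sub: "{i, j} \<subseteq> {1..N}" if "j \<in> {1..N}" for j using that assms by auto
  define A where "A j = (if j \<in> {1..N} then Query {i, j} (\<lambda>k. Output (if k = i then 1 else 0)) else Output 0)" for j
  have R: "R = bind_pmf (orc {1..N}) (\<lambda>j. result orc (A j))"
    by (simp add: R_def comparison_alg_def A_def)
  have finA: "finite (set_pmf (result orc (A j)))" for j
    using finite_oracle[OF sub, of j i] assms by (simp add: A_def)
  have fin: "finite (set_pmf (orc {1..N}))" using finite_oracle[OF order.refl assms(1,2)] .
  show "finite (set_pmf R)" unfolding R using fin finA by simp
  show "x = 0 \<or> x = 1" if "x \<in> set_pmf R" for x
    using that unfolding R by (auto simp: A_def split: if_splits)
  have "expect (result orc (A j)) (\<lambda>x. x) = (if j = i then 1 else d i / (d i + d j))"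
    if j: "j \<in> {1..N}" for j
  proof -
    have "result orc (A j) = map_pmf (\<lambda>k. if k = i then 1 else 0) (orc {i, j})"
      using j by (simp add: A_def map_pmf_def)
    hence "expect (result orc (A j)) (\<lambda>x. x) = expect (orc {i, j}) (\<lambda>k. if k = i then 1 else 0)"
      by simp
    also have "\<dots> = (\<Sum>k\<in>{i, j}. (if k = i then 1 else 0) * d k) / sum d {i, j}"
      by (rule expect_oracle[OF sub[OF j] _ assms(2)]) simp
    finally show ?thesis using assms(2) by (cases "j = i") auto
  qed
  hence "(\<Sum>j=1..N. expect (result orc (A j)) (\<lambda>x. x) * d j) = win i"
    unfolding win_def by (intro sum.cong) simp_all
  moreover have "expect R (\<lambda>x. x) = expect (orc {1..N}) (\<lambda>j. expect (result orc (A j)) (\<lambda>x. x))"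
    unfolding R using fin finA by (rule expect_bind_finite)
  ultimately show "expect R (\<lambda>x. x) = win i" unfolding expect_full by simp
qed

text \<open>Given the random subset, both moments are controlled by sums of
  \<open>beaten_by i\<close> over it; averaging over the subset then yields
  \<open>a + 2 * (a + a\<^sup>2)\<close> for the second.\<close>

lemma result_count:
  assumes "i \<in> {1..N}" "d i > 0" "0 \<le> \<tau>" "\<tau> \<le> 1"
  defines "R \<equiv> result orc (count_alg N \<tau> i)" and "a \<equiv> \<tau> * sum (beaten_by i) ({1..N} - {i})"
  shows "finite (set_pmf R)" "\<And>x. x \<in> set_pmf R \<Longrightarrow> 0 \<le> x"
    "expect R (\<lambda>x. x) = a" "expect R (\<lambda>x. x\<^sup>2) \<le> 3 * a + 2 * a\<^sup>2"
proof -
  define xs where "xs = filter (\<lambda>j. j \<noteq> i) [1..<Suc N]"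
  have xs: "distinct xs" "set xs = {1..N} - {i}" by (auto simp: xs_def)
  define U where "U = random_subset \<tau> xs"
  define Q where "Q S = result orc (draw_until N i S)" for S
  have U: "insert i S \<subseteq> {1..N}" "i \<notin> S" "card S \<le> N" "finite S" if "S \<in> set_pmf U" for S
  proof -
    have sub: "S \<subseteq> {1..N} - {i}" using that set_random_subset[of S \<tau> xs] xs by (simp add: U_def)
    thus "insert i S \<subseteq> {1..N}" "i \<notin> S" using assms(1) by auto
    show "finite S" using sub finite_subset by blast
    have "card S \<le> card {1..N}" using sub by (intro card_mono) auto
    thus "card S \<le> N" by simp
  qed
  have finU: "finite (set_pmf U)" unfolding U_def by auto
  have R: "R = bind_pmf U Q"
  proof -
    have "R = bind_pmf U (\<lambda>S. Q (set_decode (set_encode S) \<inter> {1..N} - {i}))"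
      by (simp add: R_def count_alg_def bind_map_pmf U_def xs_def Q_def del: upt_Suc)
    also have "\<dots> = bind_pmf U Q"
    proof (intro bind_pmf_cong refl)
      fix S assume S: "S \<in> set_pmf U"
      hence "S \<inter> {1..N} - {i} = S" using U[OF S] by auto
      thus "Q (set_decode (set_encode S) \<inter> {1..N} - {i}) = Q S" using U[OF S] by simp
    qed
    finally show ?thesis .
  qed
  have finQ: "finite (set_pmf (Q S))" "\<And>x. x \<in> set_pmf (Q S) \<Longrightarrow> 0 \<le> x" if "S \<in> set_pmf U" for S
    using draw_until_finite[OF U(1)[OF that] assms(2), of N] by (auto simp: Q_def)
  show "finite (set_pmf R)" unfolding R using finU finQ by auto
  show "0 \<le> x" if "x \<in> set_pmf R" for x using that finQ unfolding R by auto
  have "expect R (\<lambda>x. x) = expect U (\<lambda>S. expect (Q S) (\<lambda>x. x))"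
    unfolding R using finU finQ by (intro expect_bind_finite)
  also have "\<dots> = expect U (sum (beaten_by i))"
    unfolding Q_def using U assms(2) by (intro expect_cong draw_until_first_moment) auto
  also have "\<dots> = a"
    using random_subset_first_moment[OF assms(3,4) xs(1), of "beaten_by i"] by (simp add: U_def a_def xs)
  finally show "expect R (\<lambda>x. x) = a" .
  have "expect R (\<lambda>x. x\<^sup>2) = expect U (\<lambda>S. expect (Q S) (\<lambda>x. x\<^sup>2))"
    unfolding R using finU finQ by (intro expect_bind_finite)
  also have "\<dots> \<le> expect U (\<lambda>S. sum (beaten_by i) S + 2 * (sum (beaten_by i) S)\<^sup>2)"
    unfolding Q_def using U assms(2) finU
    by (intro expect_mono_finite draw_until_second_moment) auto
  also have "\<dots> = a + 2 * expect U (\<lambda>S. (sum (beaten_by i) S)\<^sup>2)"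
    using finU random_subset_first_moment[OF assms(3,4) xs(1), of "beaten_by i"]
    by (simp add: expect_add_finite U_def a_def xs)
  also have "\<dots> \<le> a + 2 * (a + a\<^sup>2)"
    using random_subset_second_moment[OF assms(3,4) xs(1), of "beaten_by i"] beaten_by_bounds
    by (simp add: U_def a_def xs)
  finally show "expect R (\<lambda>x. x\<^sup>2) \<le> 3 * a + 2 * a\<^sup>2" by simp
qed

lemma result_ratio:
  assumes "i \<in> {1..N}" "d i > 0" "0 \<le> \<tau>" "m > 0"
  shows "result orc (ratio_alg N \<tau> m i) =
     bind_pmf (iid_sum m (result orc (comparison_alg N i))) (\<lambda>y.
       map_pmf (\<lambda>x. min 1 ((\<tau> + x / m) / (y / m))) (iid_sum m (result orc (count_alg N \<tau> i))))"
proof -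
  define X where "X = run orc (repeat_alg m (count_alg N \<tau> i))"
  define g where "g y x = min 1 ((\<tau> + x / m) / (y / m))" for x y :: real
  have q: "real q \<le> v + m" if "(v, q) \<in> set_pmf X" for v q
    using that unfolding X_def
    by (rule run_repeat_queries[rotated]) (auto simp: count_alg_def intro: draw_until_queries)
  have "map_pmf (g y) (map_pmf (\<lambda>(v, q). if q \<le> 2 * m then v else real m) X)
      = map_pmf (g y) (map_pmf fst X)"
    if y: "y \<in> set_pmf (iid_sum m (result orc (comparison_alg N i)))" for y
  proof -
    have "0 \<le> y" "y \<le> m"
      using y result_comparison(2)[OF assms(1,2)] iid_sum_nonneg[OF _ y] iid_sum_le[OF _ y] by force+
    have *: "g y v = g y m" if "v \<ge> m" for v :: real
    proof (cases "y = 0")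
      case False
      have "1 \<le> (\<tau> + x / m) / (y / m)" if "x \<ge> m" for x :: real
      proof -
        have "y / m \<le> 1" "1 \<le> x / m" using \<open>y \<le> m\<close> that assms(4) by (auto simp: field_simps)
        hence "y / m \<le> \<tau> + x / m" using assms(3) by linarith
        moreover have "0 < y / m" using False \<open>0 \<le> y\<close> assms(4) by simp
        ultimately show ?thesis by (simp only: le_divide_eq_1_pos)
      qed
      hence "g y x = 1" if "x \<ge> m" for x :: real using that unfolding g_def by (intro min_absorb1)
      thus ?thesis using that by simp
    qed (simp add: g_def)
    show ?thesis
      unfolding pmf.map_comp
    proof (intro map_pmf_cong refl)
      fix z assume z: "z \<in> set_pmf X"
      obtain v q where [simp]: "z = (v, q)" by force
      show "(g y \<circ> (\<lambda>(v, q). if q \<le> 2 * m then v else real m)) z = (g y \<circ> fst) z"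
        using q[of v q] z *[of v] by auto
    qed
  qed
  thus ?thesis
    unfolding ratio_alg_def result_bind result_limit result_repeat[of orc m "comparison_alg N i"]
      result_repeat[of orc m "count_alg N \<tau> i", symmetric] result_def[of orc "repeat_alg m (count_alg N \<tau> i)"]
      result_simps X_def[symmetric] g_def[symmetric] map_pmf_def[of "g _" "map_pmf _ _", symmetric]
    by (intro bind_pmf_cong refl)
qed

text \<open>Both error terms of \<open>min_ratio_error\<close> are of order
  \<open>sqrt (F / m)\<close>, and dividing by \<open>F\<close> gives
  \<open>1 / sqrt (m * F)\<close>. The two contribute \<open>2\<close> each to the constant.\<close>

lemma ratio_bias:
  assumes "i \<in> {1..N}" "d i > 0" "0 \<le> \<tau>" "\<tau> \<le> 1" "m > 0"
  defines "R \<equiv> result orc (ratio_alg N \<tau> m i)"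
  shows "finite (set_pmf R)" "\<And>x. x \<in> set_pmf R \<Longrightarrow> 0 \<le> x \<and> x \<le> 1"
    "\<bar>expect R (\<lambda>x. x) - min 1 (\<tau> / d i)\<bar> \<le> 4 / sqrt (m * win i)"
proof -
  define F where "F = win i"
  define a' where "a' = \<tau> * sum (beaten_by i) ({1..N} - {i})"
  define a where "a = \<tau> + a'"
  define CY where "CY = result orc (comparison_alg N i)"
  define CX where "CX = result orc (count_alg N \<tau> i)"
  define Y where "Y = iid_sum m CY"
  define X where "X = iid_sum m CX"
  define g where "g y x = min 1 ((\<tau> + x / m) / (y / m))" for x y :: real
  note cy = result_comparison[OF assms(1,2), folded CY_def F_def]
  note cx = result_count[OF assms(1-4), folded CX_def a'_def]
  have F: "F > 0" "F \<le> 1" using win_pos[OF assms(1,2)] win_le_1 by (auto simp: F_def)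
  have a': "a' \<ge> 0" unfolding a'_def using assms(3) by (intro mult_nonneg_nonneg sum_nonneg beaten_by_bounds)
  have "d i * a = \<tau> * F"
    unfolding a_def a'_def F_def win_eq[OF assms(1)] by (simp add: algebra_simps)
  hence aF: "a / F = \<tau> / d i" using F assms(2) by (simp add: field_simps)
  have R: "R = bind_pmf Y (\<lambda>y. map_pmf (g y) X)"
    unfolding R_def result_ratio[OF assms(1-3,5)] X_def Y_def CX_def CY_def g_def ..
  have fin: "finite (set_pmf X)" "finite (set_pmf Y)" using cx cy by (auto simp: X_def Y_def)
  have nn: "x \<ge> 0" if "x \<in> set_pmf X" for x 
    using iid_sum_nonneg[of CX] cx(2) that unfolding X_def by blast
  have "0 \<le> y" if "y \<in> set_pmf CY" for y using cy(2)[OF that] by auto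
  hence nn': "y \<ge> 0" if "y \<in> set_pmf Y" for y
    using iid_sum_nonneg[of CY] that unfolding Y_def by blast
  show "finite (set_pmf R)" unfolding R using fin by auto
  show "0 \<le> x \<and> x \<le> 1" if "x \<in> set_pmf R" for x
    using that nn nn' assms(3) unfolding R by (auto simp: g_def)
  \<comment> \<open>The damping factor of \<open>min_ratio_error\<close>; it compensates for the
    variance of the count growing like the square of its mean.\<close>
  define c where "c = (if a \<le> F then 1 else F / a)"
  have c: "c \<ge> 0" using F a' assms(3) by (auto simp: c_def a_def)
  \<comment> \<open>A \<open>0\<close>/\<open>1\<close> outcome has second moment equal to its mean,
    so its variance is at most \<open>F\<close>.\<close>
  have expY: "expect Y (\<lambda>y. \<bar>y / m - F\<bar>) \<le> sqrt (F / m)"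
  proof -
    have "expect CY (\<lambda>x. x\<^sup>2) = expect CY (\<lambda>x. x)" using cy(2) by (intro expect_cong) force
    hence "expect CY (\<lambda>x. (x - F)\<^sup>2) \<le> F"
      using expect_variance_finite[OF cy(1), of "\<lambda>x. x"] cy(3) by simp
    thus ?thesis using iid_mean_deviation[OF cy(1) assms(5), of F] cy(3) by (simp add: Y_def)
  qed
  have expX: "expect X (\<lambda>x. c * \<bar>\<tau> + x / m - a\<bar>) \<le> 2 * sqrt (F / m)"
  proof -
    \<comment> \<open>The second moment bound \<open>3 * a' + 2 * a'\<^sup>2\<close> minus the
      squared mean.\<close>
    define V where "V = 3 * a' + a'\<^sup>2"
    have "expect CX (\<lambda>x. (x - a')\<^sup>2) \<le> V"
      using expect_variance_finite[OF cx(1), of "\<lambda>x. x"] cx(3,4) by (simp add: V_def)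
    hence "expect X (\<lambda>x. \<bar>x / m - a'\<bar>) \<le> sqrt (V / m)"
      using iid_mean_deviation[OF cx(1) assms(5), of V] cx(3) by (simp add: X_def)
    hence "c * expect X (\<lambda>x. \<bar>x / m - a'\<bar>) \<le> c * sqrt (V / m)"
      using c by (rule mult_left_mono)
    also have "\<dots> = sqrt (c\<^sup>2 * V / m)"
      using c by (simp add: real_sqrt_mult real_sqrt_divide)
    also have "\<dots> \<le> sqrt (4 * F / m)"
    proof -
      \<comment> \<open>If \<open>a \<le> F\<close>, then \<open>a' \<le> F \<le> 1\<close> and
        \<open>V \<le> 4 * a'\<close>. Otherwise \<open>c = F / a\<close> turns the two parts of
        \<open>V\<close> into at most \<open>3 * F\<close> and \<open>F\<close>.\<close>
      have "c\<^sup>2 * V \<le> 4 * F"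
      proof (cases "a \<le> F")
        case True
        hence "a' \<le> F" "a' \<le> 1" using F assms(3) by (auto simp: a_def)
        moreover have "a'\<^sup>2 \<le> a'" using a' \<open>a' \<le> 1\<close> by (simp add: power2_eq_square mult_left_le)
        ultimately show ?thesis using True by (simp add: c_def V_def)
      next
        case False
        have "V \<le> 3 * a + a\<^sup>2"
          using a' assms(3) unfolding V_def a_def by (intro add_mono power_mono) auto
        hence "c\<^sup>2 * V \<le> c\<^sup>2 * (3 * a + a\<^sup>2)" by (intro mult_left_mono) auto
        also have "\<dots> = 3 * F * (F / a) + F * F"
          using False F by (simp add: c_def power2_eq_square field_simps)
        also have "\<dots> \<le> 3 * F * 1 + F * 1"
          using False F by (intro add_mono mult_left_mono) auto
        finally show ?thesis by simp
      qed
      thus ?thesis by (intro real_sqrt_le_mono divide_right_mono) auto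
    qed
    also have "\<dots> = 2 * sqrt (F / m)" by (simp add: real_sqrt_mult flip: times_divide_eq_right)
    also have "c * expect X (\<lambda>x. \<bar>x / m - a'\<bar>) = expect X (\<lambda>x. c * \<bar>\<tau> + x / m - a\<bar>)"
      by (simp add: a_def)
    finally show ?thesis .
  qed
  have "\<bar>expect R (\<lambda>x. x) - min 1 (\<tau> / d i)\<bar> = \<bar>expect R (\<lambda>x. x - min 1 (a / F))\<bar>"
    using fin by (simp add: R expect_diff_finite aF)
  also have "\<dots> \<le> expect R (\<lambda>x. \<bar>x - min 1 (a / F)\<bar>)"
    by (rule integral_abs_bound)
  also have "\<dots> = expect Y (\<lambda>y. expect X (\<lambda>x. \<bar>g y x - min 1 (a / F)\<bar>))"
    unfolding R using fin by (simp add: expect_bind_finite)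
  also have "\<dots> \<le> expect Y (\<lambda>y. expect X (\<lambda>x. (2 * \<bar>y / m - F\<bar> + c * \<bar>\<tau> + x / m - a\<bar>) / F))"
    unfolding g_def c_def
    using fin F a' assms(3) nn nn'
    by (intro expect_mono_finite min_ratio_error) (auto simp: a_def)
  also have "\<dots> = (2 * expect Y (\<lambda>y. \<bar>y / m - F\<bar>) + expect X (\<lambda>x. c * \<bar>\<tau> + x / m - a\<bar>)) / F"
    using fin by (simp add: expect_add_finite)
  also have "\<dots> \<le> (2 * sqrt (F / m) + 2 * sqrt (F / m)) / F"
    using expX expY F by (intro divide_right_mono add_mono mult_left_mono) auto
  also have "\<dots> = 4 / sqrt (m * F)"
  proof -
    have "sqrt (F / m) / F = 1 / sqrt (m * F)"
      using F assms(5) real_sqrt_mult_self[of F] by (simp add: real_sqrt_mult real_sqrt_divide field_simps)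
    thus ?thesis by (simp add: field_simps)
  qed
  finally show "\<bar>expect R (\<lambda>x. x) - min 1 (\<tau> / d i)\<bar> \<le> 4 / sqrt (m * win i)" by (simp add: F_def)
qed

section \<open>From capped ratios to the total variation distance\<close>

lemma d_TV_eq:
  assumes "distribution_on N Dstar"
  shows "d_TV N D Dstar = 1 - (\<Sum>i=1..N. min 1 (pmf Dstar i / d i) * d i)"
proof -
  have sum_Dstar: "(\<Sum>i=1..N. pmf Dstar i) = 1"
    by (rule sum_pmf_eq_1) (use assms in \<open>auto simp: distribution_on_def\<close>)
  \<comment> \<open>The last summand is zero, as both distributions have total mass 1; it makes the
    equality hold term by term.\<close>
  have "d_TV N D Dstar = (\<Sum>i=1..N. d i) - (\<Sum>i=1..N. min 1 (pmf Dstar i / d i) * d i)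
      + 1 / 2 * ((\<Sum>i=1..N. pmf Dstar i) - (\<Sum>i=1..N. d i))"
    unfolding d_TV_def sum_distrib_left sum_subtractf[symmetric] sum.distrib[symmetric]
  proof (intro sum.cong refl)
    fix i
    have "min 1 (pmf Dstar i / d i) * d i = min (d i) (pmf Dstar i)"
      by (cases "d i = 0") (auto simp: min_def field_simps less_le)
    moreover have "\<bar>d i - pmf Dstar i\<bar> = d i + pmf Dstar i - 2 * min (d i) (pmf Dstar i)"
      by (simp add: min_def abs_if)
    ultimately show "1 / 2 * \<bar>d i - pmf Dstar i\<bar> = d i - min 1 (pmf Dstar i / d i) * d i
        + 1 / 2 * (pmf Dstar i - d i)"
      by (simp add: diff_divide_distrib)
  qed
  thus ?thesis unfolding sum_Dstar sum_d by simp
qed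

text \<open>A single index may have large bias, but the bias weighted by \<open>d i\<close> sums to
  at most \<open>4 / sqrt m\<close> times the bound \<open>2 * sqrt 2\<close> of
  \<open>sum_d_div_sqrt_win\<close>.\<close>

lemma trial_bias:
  assumes "distribution_on N Dstar" "m > 0"
  defines "R \<equiv> result orc (trial_alg N Dstar m)"
  shows "finite (set_pmf R)" "\<And>x. x \<in> set_pmf R \<Longrightarrow> 0 \<le> x \<and> x \<le> 1"
    "\<bar>expect R (\<lambda>x. x) - (1 - d_TV N D Dstar)\<bar> \<le> 8 * sqrt 2 / sqrt m"
proof -
  define Q where "Q i = result orc (if i \<in> {1..N} then ratio_alg N (pmf Dstar i) m i else Output 0)" for i
  have R: "R = bind_pmf (orc {1..N}) Q" unfolding R_def trial_alg_def Q_def result_simps ..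
  have pos: "i \<in> {1..N}" "d i > 0" if "i \<in> set_pmf (orc {1..N})" for i
    using that set_full set_D by (auto simp: pmf_positive)
  have bias: "finite (set_pmf (Q i))" "\<And>x. x \<in> set_pmf (Q i) \<Longrightarrow> 0 \<le> x \<and> x \<le> 1"
    "\<bar>expect (Q i) (\<lambda>x. x) - min 1 (pmf Dstar i / d i)\<bar> \<le> 4 / sqrt (m * win i)"
    if i: "i \<in> {1..N}" "d i > 0" for i
  proof -
    have Q: "Q i = result orc (ratio_alg N (pmf Dstar i) m i)"
      unfolding Q_def using i(1) by (simp only: if_True)
    note rb = ratio_bias[where \<tau> = "pmf Dstar i", OF i pmf_nonneg pmf_le_1 assms(2), folded Q]
    show "finite (set_pmf (Q i))" by (fact rb(1))
    show "\<And>x. x \<in> set_pmf (Q i) \<Longrightarrow> 0 \<le> x \<and> x \<le> 1" by (fact rb(2))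
    show "\<bar>expect (Q i) (\<lambda>x. x) - min 1 (pmf Dstar i / d i)\<bar> \<le> 4 / sqrt (m * win i)" by (fact rb(3))
  qed
  have fin: "finite (set_pmf (orc {1..N}))"
    using set_full set_D by (meson finite_atLeastAtMost finite_subset)
  show "finite (set_pmf R)" 
    unfolding R set_bind_pmf by (intro finite_UN_I fin bias(1) pos)
  show "0 \<le> x \<and> x \<le> 1" if "x \<in> set_pmf R" for x
    using that bias(2)[OF pos] unfolding R set_bind_pmf by blast
  have "expect R (\<lambda>x. x) = expect (orc {1..N}) (\<lambda>i. expect (Q i) (\<lambda>x. x))"
    unfolding R by (intro expect_bind_finite fin bias(1) pos)
  hence "expect R (\<lambda>x. x) - (1 - d_TV N D Dstar)
      = (\<Sum>i=1..N. (expect (Q i) (\<lambda>x. x) - min 1 (pmf Dstar i / d i)) * d i)"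
    unfolding expect_full d_TV_eq[OF assms(1)] left_diff_distrib sum_subtractf by simp
  also have "\<bar>\<dots>\<bar> \<le> (\<Sum>i=1..N. 4 / sqrt m * (d i / sqrt (win i)))"
  proof (rule order.trans[OF sum_abs sum_mono])
    fix i assume i: "i \<in> {1..N}"
    show "\<bar>(expect (Q i) (\<lambda>x. x) - min 1 (pmf Dstar i / d i)) * d i\<bar> \<le> 4 / sqrt m * (d i / sqrt (win i))"
    proof (cases "d i = 0")
      case False
      hence di: "d i > 0" by (simp add: less_le)
      have "\<bar>expect (Q i) (\<lambda>x. x) - min 1 (pmf Dstar i / d i)\<bar> * d i \<le> 4 / sqrt (m * win i) * d i"
        using bias(3)[OF i di] di by (intro mult_right_mono) auto
      thus ?thesis by (simp add: abs_mult real_sqrt_mult)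
    qed simp
  qed
  also have "\<dots> \<le> 4 / sqrt m * (2 * sqrt 2)"
    unfolding sum_distrib_left[symmetric] by (intro mult_left_mono sum_d_div_sqrt_win) auto
  finally show "\<bar>expect R (\<lambda>x. x) - (1 - d_TV N D Dstar)\<bar> \<le> 8 * sqrt 2 / sqrt m" by simp
qed

text \<open>The error is split in half. \<open>m\<close> makes the bias
  \<open>8 * sqrt 2 / sqrt m\<close> at most \<open>\<epsilon> / 2\<close>, and \<open>n\<close>
  makes the Chebyshev bound \<open>4 / (n * \<epsilon>\<^sup>2)\<close> at most one third, since
  trials in the unit interval have variance at most 1.\<close>

lemma tv_alg_correct:
  assumes "distribution_on N Dstar" "\<epsilon> > 0" "m \<ge> 512 / \<epsilon>\<^sup>2" "n \<ge> 12 / \<epsilon>\<^sup>2"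
  shows "measure_pmf.prob (run orc (tv_alg N Dstar m n)) {(v, q). \<bar>v - d_TV N D Dstar\<bar> \<le> \<epsilon>} \<ge> 2 / 3"
proof -
  have "0 < 512 / \<epsilon>\<^sup>2" "0 < 12 / \<epsilon>\<^sup>2" using assms(2) by auto
  hence pos: "m > 0" "n > 0" using assms(3,4) by (auto intro!: gr0I)
  define R where "R = result orc (trial_alg N Dstar m)"
  define \<mu> where "\<mu> = expect R (\<lambda>x. x)"
  define Z where "Z = iid_sum n R"
  note tb = trial_bias[OF assms(1) pos(1), folded R_def]
  have "8 * sqrt 2 / sqrt m \<le> \<epsilon> / 2"
  proof -
    have "sqrt (512 / \<epsilon>\<^sup>2) \<le> sqrt m" using assms(3) by simp
    hence "sqrt 512 / \<epsilon> \<le> sqrt m" using assms(2) by (simp add: real_sqrt_divide)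
    moreover have "sqrt 512 = 16 * sqrt 2" using real_sqrt_mult[of 256 2] by simp
    ultimately show ?thesis using assms(2) pos(1) by (simp add: field_simps)
  qed
  hence bias: "\<bar>\<mu> - (1 - d_TV N D Dstar)\<bar> \<le> \<epsilon> / 2" using tb(3) by (simp add: \<mu>_def)
  have var: "expect R (\<lambda>x. (x - \<mu>)\<^sup>2) \<le> 1"
  proof -
    have "expect R (\<lambda>x. x\<^sup>2) \<le> expect R (\<lambda>_. 1)"
      using tb by (intro expect_mono_finite) (auto simp: abs_square_le_1)
    thus ?thesis
      using expect_variance_finite[OF tb(1), of "\<lambda>x. x"] by (simp add: \<mu>_def) (smt (verit) zero_le_power2)
  qed
  have "measure_pmf.prob Z {x. \<bar>x / n - \<mu>\<bar> \<ge> \<epsilon> / 2} \<le> 1 / (n * (\<epsilon> / 2)\<^sup>2)"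
    using iid_mean_Chebyshev[OF tb(1) pos(2) _ var[unfolded \<mu>_def], of "\<epsilon> / 2"] assms(2)
    by (simp add: Z_def \<mu>_def)
  also have "\<dots> \<le> 1 / 3"
    using assms(2,4) pos(2) by (simp add: field_simps power2_eq_square)
  finally have tail: "measure_pmf.prob Z {x. \<bar>x / n - \<mu>\<bar> \<ge> \<epsilon> / 2} \<le> 1 / 3" .
  have "2 / 3 \<le> 1 - measure_pmf.prob Z {x. \<bar>x / n - \<mu>\<bar> \<ge> \<epsilon> / 2}" using tail by simp
  also have "\<dots> = measure_pmf.prob Z (- {x. \<bar>x / n - \<mu>\<bar> \<ge> \<epsilon> / 2})"
    by (subst measure_pmf.prob_compl[symmetric]) (auto simp: Compl_eq_Diff_UNIV)
  also have "\<dots> \<le> measure_pmf.prob Z {z. \<bar>(1 - z / n) - d_TV N D Dstar\<bar> \<le> \<epsilon>}"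
  proof (intro measure_pmf.finite_measure_mono subsetI)
    fix z assume "z \<in> - {x. \<bar>x / n - \<mu>\<bar> \<ge> \<epsilon> / 2}"
    hence "\<bar>z / n - \<mu>\<bar> < \<epsilon> / 2" by simp
    with bias have "\<bar>(1 - z / n) - d_TV N D Dstar\<bar> \<le> \<epsilon>" by linarith
    thus "z \<in> {z. \<bar>(1 - z / n) - d_TV N D Dstar\<bar> \<le> \<epsilon>}" by simp
  qed simp
  also have "\<dots> = measure_pmf.prob (result orc (tv_alg N Dstar m n)) {v. \<bar>v - d_TV N D Dstar\<bar> \<le> \<epsilon>}"
  proof -
    have "result orc (tv_alg N Dstar m n) = map_pmf (\<lambda>z. 1 - z / n) Z"
      by (simp add: tv_alg_def result_repeat Z_def R_def map_pmf_def)
    thus ?thesis by (simp add: vimage_def)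
  qed
  also have "\<dots> = measure_pmf.prob (run orc (tv_alg N Dstar m n)) {(v, q). \<bar>v - d_TV N D Dstar\<bar> \<le> \<epsilon>}"
    by (simp add: result_def vimage_def case_prod_unfold)
  finally show ?thesis .
qed

end

theorem theorem1p2:
  "\<exists>(C::real) (k::nat). \<forall>(N::nat) (Dstar::nat pmf). distribution_on N Dstar \<longrightarrow>
     (\<exists>A :: real \<Rightarrow> cond_alg. \<forall>\<epsilon>::real. 0 < \<epsilon> \<and> \<epsilon> < 1 \<longrightarrow>
        (\<forall>S \<in> query_sets (A \<epsilon>). S \<subseteq> {1..N}) \<and>
        (\<forall>(D::nat pmf) (orc :: nat set \<Rightarrow> nat pmf).
           distribution_on N D \<and> is_cond_oracle N D orc \<longrightarrow>
             (\<forall>(v, q) \<in> set_pmf (run orc (A \<epsilon>)).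
                real q \<le> C * (1 / \<epsilon>) ^ 4 * (1 + ln (1 / \<epsilon>)) ^ k) \<and>
             measure_pmf.prob (run orc (A \<epsilon>)) {(v, q). \<bar>v - d_TV N D Dstar\<bar> \<le> \<epsilon>} \<ge> 2 / 3))"
\<comment> \<open>The exponent \<open>0\<close> means that no logarithmic factor occurs. The
  constant is \<open>13 * (4 * 513 + 1)\<close>, from \<open>n * (4 * m + 1)\<close>
  queries.\<close>
proof (rule exI[of _ 26689], rule exI[of _ 0], intro allI impI)
  fix N :: nat and Dstar :: "nat pmf"
  assume Dstar: "distribution_on N Dstar"
  define m where "m \<epsilon> = nat \<lceil>512 / \<epsilon>\<^sup>2\<rceil>" for \<epsilon> :: real
  define n where "n \<epsilon> = nat \<lceil>12 / \<epsilon>\<^sup>2\<rceil>" for \<epsilon> :: real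
  define A where "A \<epsilon> = tv_alg N Dstar (m \<epsilon>) (n \<epsilon>)" for \<epsilon> :: real
  show "\<exists>A :: real \<Rightarrow> cond_alg. \<forall>\<epsilon>::real. 0 < \<epsilon> \<and> \<epsilon> < 1 \<longrightarrow>
        (\<forall>S \<in> query_sets (A \<epsilon>). S \<subseteq> {1..N}) \<and>
        (\<forall>(D::nat pmf) (orc :: nat set \<Rightarrow> nat pmf).
           distribution_on N D \<and> is_cond_oracle N D orc \<longrightarrow>
             (\<forall>(v, q) \<in> set_pmf (run orc (A \<epsilon>)).
                real q \<le> 26689 * (1 / \<epsilon>) ^ 4 * (1 + ln (1 / \<epsilon>)) ^ 0) \<and>
             measure_pmf.prob (run orc (A \<epsilon>)) {(v, q). \<bar>v - d_TV N D Dstar\<bar> \<le> \<epsilon>} \<ge> 2 / 3)"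
  proof (rule exI[of _ A], intro allI impI conjI)
    fix \<epsilon> :: real assume \<epsilon>: "0 < \<epsilon> \<and> \<epsilon> < 1"
    show "\<forall>S \<in> query_sets (A \<epsilon>). S \<subseteq> {1..N}"
      using query_sets_tv unfolding A_def by blast
    fix D orc assume D: "distribution_on N D \<and> is_cond_oracle N D orc"
    interpret cond_oracle N D orc using D by unfold_locales auto
    show "measure_pmf.prob (run orc (A \<epsilon>)) {(v, q). \<bar>v - d_TV N D Dstar\<bar> \<le> \<epsilon>} \<ge> 2 / 3"
      unfolding A_def using \<epsilon> by (intro tv_alg_correct Dstar) (auto simp: m_def n_def real_nat_ceiling_ge)
    define t where "t = 1 / \<epsilon>\<^sup>2"
    \<comment> \<open>This absorbs the rounding up: \<open>512 * t + 1 \<le> 513 * t\<close> and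
      \<open>12 * t + 1 \<le> 13 * t\<close>.\<close>
    have t: "t \<ge> 1" using \<epsilon> by (simp add: t_def power_le_one)
    have "real (m \<epsilon>) \<le> 513 * t" "real (n \<epsilon>) \<le> 13 * t"
    proof -
      have "real (m \<epsilon>) \<le> 512 * t + 1" "real (n \<epsilon>) \<le> 12 * t + 1"
        using t by (auto simp: m_def n_def t_def)
      thus "real (m \<epsilon>) \<le> 513 * t" "real (n \<epsilon>) \<le> 13 * t" using t by auto
    qed
    hence "real (n \<epsilon>) * (4 * real (m \<epsilon>) + 1) \<le> (13 * t) * (4 * (513 * t) + t)"
      using t by (intro mult_mono add_mono) auto
    hence bound: "real (n \<epsilon> * (4 * m \<epsilon> + 1)) \<le> 26689 * (1 / \<epsilon>) ^ 4"
      using \<epsilon> by (simp add: t_def power_divide field_simps power4_eq_xxxx power2_eq_square)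
    show "\<forall>(v, q) \<in> set_pmf (run orc (A \<epsilon>)). real q \<le> 26689 * (1 / \<epsilon>) ^ 4 * (1 + ln (1 / \<epsilon>)) ^ 0"
    proof clarify
      fix v q assume "(v, q) \<in> set_pmf (run orc (A \<epsilon>))"
      hence "q \<le> n \<epsilon> * (4 * m \<epsilon> + 1)"
        unfolding A_def by (intro queries_leD[OF queries_le_tv])
      hence "real q \<le> real (n \<epsilon> * (4 * m \<epsilon> + 1))" by (rule of_nat_mono)
      thus "real q \<le> 26689 * (1 / \<epsilon>) ^ 4 * (1 + ln (1 / \<epsilon>)) ^ 0" using bound by simp
    qed
  qed
qed

end
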